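(* Let $X$ be a proper geodesic $\mathrm{CAT}(-1)$ metric space having at least two points, whose boundary at infinity $\partial_\infty X$ is arcwise connected and which has extendible geodesics. Let $(H_\alpha)_{\alpha\in\mathcal A}$ be any family of (closed) balls or horoballs in $X$ with pairwise disjoint interiors, and let $\mu_0=1.534$. (1) For every $x\in X-\bigcup_{\alpha\in\mathcal A}H_\alpha$, there exists a geodesic ray starting from $x$ which avoids $H_\alpha[\mu_0]$ for every $\alpha\in\mathcal A$. (2) For every $\alpha_0\in\mathcal A$ such that $H_{\alpha_0}$ is a horoball, there exists a geodesic line starting from the point at infinity of $H_{\alpha_0}$ which avoids $H_\alpha[\mu_0]$ for every $\alpha\neq\alpha_0$.
   Context: A geodesic ray is an isometric map $[\iota_0,+\infty[\to X$, a geodesic line an isometric map $\mathbb R\to X$; a geodesic line starts from $\xi\in\partial_\infty X$ if $\gamma(-\infty)=\xi$. $X$ has extendible geodesics if every geodesic segment extends to a geodesic line. For $\xi\in\partial_\infty X$ the Busemann function is $\beta_\xi(x,y)=\lim_{t\to\infty}(d(x,\rho(t))-d(y,\rho(t)))$ for any geodesic ray $\rho$ converging to $\xi$. A horoball centered at $\xi$ is a set $H=\{y:\beta_\xi(x,y)\ge s\}$ (for some $x\in X$, $s\in\mathbb R$), and for $t\ge0$, $H[t]=\{y:\beta_\xi(x,y)\ge s+t\}$; its point at infinity is $\xi$. If $B$ is a closed ball of center $x$ and radius $r$, then $B[t]$ is the closed ball of center $x$ and radius $r-t$ for $t\le r$, and $B[t]=\emptyset$ for $t>r$. All balls and horoballs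 are closed. *)

theory Defs
  imports "HOL-Analysis.Analysis"
begin

definition isom_on :: "('b \<Rightarrow> 'b \<Rightarrow> real) \<Rightarrow> real set \<Rightarrow> (real \<Rightarrow> 'b) \<Rightarrow> bool" where
  "isom_on d I g \<longleftrightarrow> (\<forall>s\<in>I. \<forall>t\<in>I. d (g s) (g t) = \<bar>s - t\<bar>)"

definition geoseg :: "(real \<Rightarrow> 'a::metric_space) \<Rightarrow> 'a \<Rightarrow> 'a \<Rightarrow> bool" where
  "geoseg g x y \<longleftrightarrow> isom_on dist {0..dist x y} g \<and> g 0 = x \<and> g (dist x y) = y"

definition geodesic_space :: "'a::metric_space set \<Rightarrow> bool" where
  "geodesic_space X \<longleftrightarrow> (\<forall>x\<in>X. \<forall>y\<in>X. \<exists>g. geoseg g x y \<and> g ` {0..dist x y} \<subseteq> X)"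

definition proper_mspace :: "'a::metric_space set \<Rightarrow> bool" where
  "proper_mspace X \<longleftrightarrow> (\<forall>x\<in>X. \<forall>r. compact (cball x r \<inter> X))"

definition geo_ray :: "(real \<Rightarrow> 'a::metric_space) \<Rightarrow> bool" where
  "geo_ray \<rho> \<longleftrightarrow> isom_on dist {0..} \<rho>"

definition geo_line :: "(real \<Rightarrow> 'a::metric_space) \<Rightarrow> bool" where
  "geo_line \<gamma> \<longleftrightarrow> isom_on dist UNIV \<gamma>"

definition extendible_geodesics :: "'a::metric_space set \<Rightarrow> bool" where
  "extendible_geodesics (X::'a set) \<longleftrightarrow>
     (\<forall>(g::real \<Rightarrow> 'a) a b. a \<le> b \<and> isom_on dist {a..b} g \<and> g ` {a..b} \<subseteq> X \<longrightarrow>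
        (\<exists>l. geo_line l \<and> range l \<subseteq> X \<and> (\<forall>t\<in>{a..b}. l t = g t)))"

definition hyp_plane :: "complex set" where
  "hyp_plane = {z. Im z > 0}"

definition hdist :: "complex \<Rightarrow> complex \<Rightarrow> real" where
  "hdist z w = arcosh (1 + (cmod (z - w))\<^sup>2 / (2 * Im z * Im w))"

definition hgeoseg :: "(real \<Rightarrow> complex) \<Rightarrow> complex \<Rightarrow> complex \<Rightarrow> bool" where
  "hgeoseg h p q \<longleftrightarrow> h ` {0..hdist p q} \<subseteq> hyp_plane \<and> isom_on hdist {0..hdist p q} h
                       \<and> h 0 = p \<and> h (hdist p q) = q"

definition CAT_minus1 :: "'a::metric_space set \<Rightarrow> bool" where
  "CAT_minus1 (X::'a set) \<longleftrightarrow> geodesic_space X \<and>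
    (\<forall>x\<in>X. \<forall>y\<in>X. \<forall>z\<in>X. \<forall>(g1::real \<Rightarrow> 'a) g2 g3.
       geoseg g1 x y \<and> geoseg g2 y z \<and> geoseg g3 z x \<and>
       g1 ` {0..dist x y} \<subseteq> X \<and> g2 ` {0..dist y z} \<subseteq> X \<and> g3 ` {0..dist z x} \<subseteq> X \<longrightarrow>
       (\<forall>x' y' z' h1 h2 h3.
          x' \<in> hyp_plane \<and> y' \<in> hyp_plane \<and> z' \<in> hyp_plane \<and>
          hdist x' y' = dist x y \<and> hdist y' z' = dist y z \<and> hdist z' x' = dist z x \<and>
          hgeoseg h1 x' y' \<and> hgeoseg h2 y' z' \<and> hgeoseg h3 z' x' \<longrightarrow>
          (let G = [g1, g2, g3]; H = [h1, h2, h3]; L = [dist x y, dist y z, dist z x] in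
           \<forall>i<3. \<forall>j<3. \<forall>s\<in>{0..L!i}. \<forall>t\<in>{0..L!j}.
              dist ((G!i) s) ((G!j) t) \<le> hdist ((H!i) s) ((H!j) t))))"

definition asymptotic :: "(real \<Rightarrow> 'a::metric_space) \<Rightarrow> (real \<Rightarrow> 'a) \<Rightarrow> bool" where
  "asymptotic \<rho> \<rho>' \<longleftrightarrow> (\<exists>C. \<forall>t\<ge>0. dist (\<rho> t) (\<rho>' t) \<le> C)"

definition bdry :: "(real \<Rightarrow> 'a::metric_space) set set" where
  "bdry = {{\<rho>'. geo_ray \<rho>' \<and> asymptotic \<rho> \<rho>'} | \<rho>. geo_ray \<rho>}"

text \<open>Continuity of a path in the boundary for the cone topology based at x0: the rays
  from x0 representing p s' converge to the ray from x0 representing p s, uniformly on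
  compact sets (basic neighbourhoods U(c,r,\<epsilon>) of the cone topology).\<close>
definition cone_continuous_path :: "'a::metric_space \<Rightarrow> (real \<Rightarrow> (real \<Rightarrow> 'a) set) \<Rightarrow> bool" where
  "cone_continuous_path x0 p \<longleftrightarrow>
     (\<forall>s\<in>{0..1}. \<forall>r\<ge>0. \<forall>e>0. \<exists>\<delta>>0. \<forall>s'\<in>{0..1}. \<bar>s' - s\<bar> < \<delta> \<longrightarrow>
        (\<forall>\<rho> \<rho>'. \<rho> \<in> p s \<and> \<rho> 0 = x0 \<and> \<rho>' \<in> p s' \<and> \<rho>' 0 = x0 \<longrightarrow> dist (\<rho> r) (\<rho>' r) < e))"

definition bdry_arcwise_connected :: "'a::metric_space itself \<Rightarrow> bool" where
  "bdry_arcwise_connected TYPE('a) \<longleftrightarrow>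
     (\<exists>x0::'a. \<forall>\<xi>\<in>bdry. \<forall>\<eta>\<in>bdry. \<exists>p. p 0 = \<xi> \<and> p 1 = \<eta> \<and> p ` {0..1} \<subseteq> bdry
        \<and> cone_continuous_path x0 p)"

definition busemann :: "(real \<Rightarrow> 'a::metric_space) set \<Rightarrow> 'a \<Rightarrow> 'a \<Rightarrow> real" where
  "busemann \<xi> x y = (let \<rho> = (SOME \<rho>. \<rho> \<in> \<xi>) in
                      Lim at_top (\<lambda>t. dist x (\<rho> t) - dist y (\<rho> t)))"

text \<open>A region is a closed ball (center, radius) or a horoball given by
  (point at infinity \<xi>, base point x, level s), i.e. {y. busemann \<xi> x y \<ge> s}.\<close>
datatype 'a region = Ball 'a real | Horoball "(real \<Rightarrow> 'a) set" 'a real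

fun region_wf :: "'a::metric_space region \<Rightarrow> bool" where
  "region_wf (Ball x r) = True"
| "region_wf (Horoball \<xi> x s) = (\<xi> \<in> bdry)"

text \<open>H[t]; for t = 0 this is H itself. For a ball, cball x (r - t) is empty if t > r.\<close>
fun shrink :: "'a::metric_space region \<Rightarrow> real \<Rightarrow> 'a set" where
  "shrink (Ball x r) t = cball x (r - t)"
| "shrink (Horoball \<xi> x s) t = {y. busemann \<xi> x y \<ge> s + t}"

abbreviation region_set :: "'a::metric_space region \<Rightarrow> 'a set" where
  "region_set H \<equiv> shrink H 0"

end

theory Submission
  imports Defs
begin

text \<open>
  Call depth the function that is \<open>r - d(c, y)\<close> for a ball and \<open>\<beta>(x, y) - s\<close> for a horoball; both are
  pointwise limits of depth functions of balls. Suppose a ray from \<open>x\<close> enters a region, whose distance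
  to \<open>x\<close> is \<open>T\<close>, to depth more than 1. Since the boundary is arcwise connected and some ray from \<open>x\<close> runs
  away from the region, one can move the end point of the ray until the maximal depth is exactly 1. In
  a \<open>CAT(-1)\<close> space two rays from \<open>x\<close> that reach depth 1 satisfy \<open>d(\<gamma> t, \<gamma>' t) \<le> exp (t - T - 1)\<close>, so
  this modification hardly changes the ray before time \<open>T\<close>. Do this successively for the first region
  that is entered too deeply. Each visit lasts at least 2 units of time and the regions have disjoint interiors,
  hence the displacements caused by all later modifications add up to a geometric series, and the limit
  ray has depth at most \<open>3/2 < 1.534\<close> in every region. For lines from the point at infinity of a
  horoball, apply this to base points that tend to this point, keeping the rays
  close to a fixed one inside the horoball, and pass to the limit.
\<close>

section \<open>Geodesics of the upper half-plane\<close>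

lemma cosh_hdist:
  assumes "Im z > 0" "Im w > 0"
  shows "cosh (hdist z w) = 1 + (cmod (z - w))\<^sup>2 / (2 * Im z * Im w)"
  unfolding hdist_def using assms by (intro cosh_arcosh_real) simp

lemma hdist_nonneg:
  assumes "Im z > 0" "Im w > 0"
  shows "hdist z w \<ge> 0"
  unfolding hdist_def using assms by (intro arcosh_nonneg_real) simp

lemma cosh_abs_real: "cosh \<bar>x\<bar> = cosh (x::real)"
  by (simp add: abs_if)

lemma cosh_eq_cosh_iff:
  fixes x y :: real
  assumes "x \<ge> 0" "y \<ge> 0"
  shows "cosh x = cosh y \<longleftrightarrow> x = y"
  using assms cosh_real_nonneg_le_iff[of x y] cosh_real_nonneg_le_iff[of y x] by auto

lemma hdist_eqI:
  assumes "Im z > 0" "Im w > 0" "1 + (cmod (z - w))\<^sup>2 / (2 * Im z * Im w) = cosh s"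
  shows "hdist z w = \<bar>s\<bar>"
proof -
  have "cosh (hdist z w) = cosh \<bar>s\<bar>"
    using cosh_hdist[OF assms(1,2)] assms(3) by (simp add: cosh_abs_real)
  then show ?thesis
    using hdist_nonneg[OF assms(1,2)] by (simp add: cosh_eq_cosh_iff)
qed

text \<open>The comparison triangles in \<open>CAT_minus1\<close> come with explicit sides, so
  hyperbolic segments have to be supplied. A full unit-speed line through both points suffices; it
  is run backwards when \<open>b < a\<close>.\<close>

lemma hgeoseg_of_isometric_line:
  assumes "isom_on hdist UNIV k" "\<And>s. k s \<in> hyp_plane" "k a = p" "k b = q"
  shows "\<exists>h. hgeoseg h p q"
proof -
  have hd: "hdist (k s) (k t) = \<bar>s - t\<bar>" for s t
    using assms(1) by (simp add: isom_on_def)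
  have pq: "hdist p q = \<bar>a - b\<bar>"
    using hd[of a b] assms(3,4) by simp
  define e :: real where "e = (if a \<le> b then 1 else -1)"
  have "hgeoseg (\<lambda>t. k (a + e * t)) p q"
    unfolding hgeoseg_def isom_on_def pq using assms(2-4) hd
    by (auto simp: e_def)
  then show ?thesis by blast
qed

lemma isom_on_vertical_line:
  "isom_on hdist UNIV (\<lambda>s. Complex u (exp s))"
  unfolding isom_on_def
proof (intro ballI)
  fix s t :: real
  have "1 + (exp s - exp t)\<^sup>2 / (2 * exp s * exp t) = cosh (s - t)"
    by (simp add: cosh_def exp_diff exp_minus field_simps power2_eq_square)
  then show "hdist (Complex u (exp s)) (Complex u (exp t)) = \<bar>s - t\<bar>"
    by (intro hdist_eqI) (auto simp: cmod_power2)
qed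

text \<open>Arc length parametrisation of the Euclidean half circle with centre \<open>u\<close> and
  radius \<open>R\<close>: \<open>tanh s\<close> and \<open>1 / cosh s\<close> are the cosine and
  sine of the polar angle.\<close>

lemma isom_on_half_circle:
  assumes "R > 0"
  shows "isom_on hdist UNIV (\<lambda>s. Complex (u + R * tanh s) (R / cosh s))"
  unfolding isom_on_def
proof (intro ballI)
  fix s t :: real
  have "cosh s \<noteq> 0" "cosh t \<noteq> 0" by auto
  moreover have "(sinh s)\<^sup>2 = (cosh s)\<^sup>2 - 1" "(sinh t)\<^sup>2 = (cosh t)\<^sup>2 - 1"
    by (simp_all add: cosh_square_eq)
  ultimately have "1 + ((R * sinh s / cosh s - R * sinh t / cosh t)\<^sup>2 + (R / cosh s - R / cosh t)\<^sup>2)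
        / (2 * (R / cosh s) * (R / cosh t)) = cosh s * cosh t - sinh s * sinh t"
    using assms by (simp add: field_simps) algebra
  then show "hdist (Complex (u + R * tanh s) (R / cosh s)) (Complex (u + R * tanh t) (R / cosh t))
     = \<bar>s - t\<bar>"
    using assms by (intro hdist_eqI) (auto simp: cmod_power2 tanh_def cosh_diff)
qed

lemma ex_hgeoseg:
  assumes "p \<in> hyp_plane" "q \<in> hyp_plane"
  shows "\<exists>h. hgeoseg h p q"
proof (cases "Re p = Re q")
  case True
  show ?thesis
    by (rule hgeoseg_of_isometric_line[OF isom_on_vertical_line[of "Re p"], of "ln (Im p)" _ "ln (Im q)"])
       (use assms True in \<open>auto simp: hyp_plane_def complex_eq_iff\<close>)
next
  case False
  \<comment> \<open>The point of the real axis at equal Euclidean distance from \<open>p\<close> and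
    \<open>q\<close>. A point \<open>z\<close> of the resulting circle has the parameter
    \<open>s\<close> with \<open>sinh s = (Re z - u) / Im z\<close>.\<close>
  define u where "u = ((cmod p)\<^sup>2 - (cmod q)\<^sup>2) / (2 * (Re p - Re q))"
  define R where "R = sqrt ((Re p - u)\<^sup>2 + (Im p)\<^sup>2)"
  have p: "Im p > 0" "Im q > 0" using assms by (auto simp: hyp_plane_def)
  have Rpos: "R > 0" unfolding R_def using p by (simp add: add_nonneg_pos)
  have "2 * u * (Re p - Re q) = (cmod p)\<^sup>2 - (cmod q)\<^sup>2"
    unfolding u_def using False by (simp only: times_divide_eq_left times_divide_eq_right) (simp add: field_simps)
  then have Rq: "R = sqrt ((Re q - u)\<^sup>2 + (Im q)\<^sup>2)"
    unfolding R_def cmod_power2 by (simp add: power2_eq_square algebra_simps)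
  have *: "Complex (u + R * tanh (arsinh ((Re z - u) / Im z))) (R / cosh (arsinh ((Re z - u) / Im z))) = z"
    if z: "Im z > 0" "R = sqrt ((Re z - u)\<^sup>2 + (Im z)\<^sup>2)" for z
  proof -
    have "sqrt (((Re z - u) / Im z)\<^sup>2 + 1) = sqrt (((Re z - u)\<^sup>2 + (Im z)\<^sup>2) / (Im z)\<^sup>2)"
      using z by (simp add: field_simps)
    also have "\<dots> = R / Im z"
      using z by (simp add: real_sqrt_divide)
    finally show ?thesis
      using z Rpos by (simp add: complex_eq_iff tanh_def cosh_arsinh_real)
  qed
  show ?thesis
    by (rule hgeoseg_of_isometric_line[OF isom_on_half_circle[OF Rpos, of u] _ *[OF p(1) R_def] *[OF p(2) Rq]])
       (use Rpos in \<open>auto simp: hyp_plane_def\<close>)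
qed

section \<open>Comparison triangles with one side on the imaginary axis\<close>

lemma cosh_hdist_imaginary_axis:
  assumes "Y > 0"
  shows "cosh (hdist (Complex X Y) (Complex 0 (exp t))) =
         (X\<^sup>2 + Y\<^sup>2) / (2 * Y) * exp (-t) + 1 / (2 * Y) * exp t"
proof -
  have "(cmod (Complex X Y - Complex 0 (exp t)))\<^sup>2 = X\<^sup>2 + (Y - exp t)\<^sup>2"
    by (simp add: cmod_power2)
  then show ?thesis
    using assms by (subst cosh_hdist) (auto simp: field_simps power2_eq_square exp_minus)
qed

text \<open>Along the imaginary axis, \<open>cosh\<close> of the distance to the unknown point is
  \<open>A * exp (-t) + B * exp t\<close>. The prescribed values at \<open>0\<close> and
  \<open>a\<close> determine \<open>A\<close> and \<open>B\<close>. Such coefficients come from a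
  point of the half-plane as soon as \<open>B > 0\<close> and \<open>4 * A * B \<ge> 1\<close>, and
  the triangle inequalities give exactly this.\<close>

lemma ex_comparison_point:
  fixes a b c :: real
  assumes "a > 0" "b \<ge> 0" "c \<ge> 0" "a \<le> b + c" "b \<le> a + c" "c \<le> a + b"
  shows "\<exists>z. Im z > 0 \<and> hdist z (Complex 0 (exp 0)) = b \<and> hdist z (Complex 0 (exp a)) = c"
proof -
  define A B where "A = (cosh b * exp a - cosh c) / (2 * sinh a)"
    and "B = (cosh c - cosh b * exp (-a)) / (2 * sinh a)"
  have sa: "sinh a > 0" using assms by simp
  have ea: "exp a = cosh a + sinh a" "exp (-a) = cosh a - sinh a"
    by (simp_all add: cosh_def sinh_def field_simps)
  have sb: "sinh b \<ge> 0" using assms by simp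
  have "cosh c \<ge> cosh (b - a)"
  proof -
    have "cosh \<bar>b - a\<bar> \<le> cosh c"
      using assms by (subst cosh_real_nonneg_le_iff) auto
    then show ?thesis by (simp add: cosh_abs_real)
  qed
  then have lo: "cosh b * cosh a - sinh b * sinh a \<le> cosh c" by (simp add: cosh_diff)
  have "cosh c \<le> cosh (a + b)"
    using assms by (subst cosh_real_nonneg_le_iff) auto
  then have hi: "cosh c \<le> cosh b * cosh a + sinh b * sinh a" by (simp add: cosh_add mult.commute)
  have "sinh b < cosh b" by (simp add: sinh_less_cosh_real)
  then have "sinh b * sinh a < cosh b * sinh a" using sa by simp
  then have "0 < cosh c - cosh b * (cosh a - sinh a)"
    using lo unfolding right_diff_distrib by linarith
  then have Bpos: "B > 0" unfolding B_def ea using sa by simp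
  have "(cosh c - cosh b * cosh a)\<^sup>2 \<le> (sinh b * sinh a)\<^sup>2"
  proof (rule abs_le_square_iff[THEN iffD1])
    have "\<bar>sinh b * sinh a\<bar> = sinh b * sinh a" using sb sa by simp
    then show "\<bar>cosh c - cosh b * cosh a\<bar> \<le> \<bar>sinh b * sinh a\<bar>"
      unfolding abs_le_iff using lo hi by simp
  qed
  moreover have "(sinh b)\<^sup>2 = (cosh b)\<^sup>2 - 1" "(cosh a)\<^sup>2 = (sinh a)\<^sup>2 + 1"
    by (simp_all add: cosh_square_eq)
  ultimately have "(sinh a)\<^sup>2 \<le> (cosh b * exp a - cosh c) * (cosh c - cosh b * exp (-a))"
    unfolding ea by (simp add: power_mult_distrib) (simp add: power2_eq_square algebra_simps)
  then have AB: "4 * A * B \<ge> 1"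
    using sa by (simp add: A_def B_def field_simps power2_eq_square)
  define X Y where "X = sqrt (A / B - (1 / (2 * B))\<^sup>2)" and "Y = 1 / (2 * B)"
  have Y: "Y > 0" using Bpos by (simp add: Y_def)
  have "A / B - (1 / (2 * B))\<^sup>2 \<ge> 0"
    using AB Bpos by (simp add: field_simps power2_eq_square)
  then have "X\<^sup>2 + Y\<^sup>2 = A / B" by (simp add: X_def Y_def)
  then have "(X\<^sup>2 + Y\<^sup>2) / (2 * Y) = A" "1 / (2 * Y) = B" using Bpos by (simp_all add: Y_def)
  then have ch: "cosh (hdist (Complex X Y) (Complex 0 (exp t))) = A * exp (-t) + B * exp t" for t
    by (simp only: cosh_hdist_imaginary_axis[OF Y])
  have h1: "A * exp (-0) + B * exp 0 = cosh b" unfolding A_def B_def ea using sa by (simp add: field_simps)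
  have h2: "A * exp (-a) + B * exp a = cosh c"
  proof -
    have "A * exp (-a) + B * exp a = (cosh c * (exp a - exp (-a))) / (2 * sinh a)"
      unfolding A_def B_def by (simp add: algebra_simps exp_minus_inverse flip: add_divide_distrib)
    also have "exp a - exp (-a) = 2 * sinh a" by (simp add: sinh_def)
    finally show ?thesis using sa by simp
  qed
  have nn: "0 \<le> hdist (Complex X Y) (Complex 0 (exp t))" for t
    using Y by (intro hdist_nonneg) auto
  have "hdist (Complex X Y) (Complex 0 (exp 0)) = b"
    using ch[of 0] h1 by (simp only: cosh_eq_cosh_iff[OF nn assms(2)])
  moreover have "hdist (Complex X Y) (Complex 0 (exp a)) = c"
    using ch[of a] h2 by (simp only: cosh_eq_cosh_iff[OF nn assms(3)])
  ultimately show ?thesis using Y by (intro exI[of _ "Complex X Y"]) simp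
qed

section \<open>Comparison inequalities\<close>

lemma isom_onD: "isom_on d I g \<Longrightarrow> s \<in> I \<Longrightarrow> t \<in> I \<Longrightarrow> d (g s) (g t) = \<bar>s - t\<bar>"
  by (simp add: isom_on_def)

lemma isom_on_subset: "isom_on d I g \<Longrightarrow> J \<subseteq> I \<Longrightarrow> isom_on d J g"
  by (auto simp: isom_on_def)

lemma two_sinh_half_squared: "2 * (sinh (x / 2))\<^sup>2 = cosh x - (1::real)"
  using cosh_double_cosh[of "x / 2"] by (simp add: cosh_square_eq)

lemma sinh_ge_self:
  fixes x :: real
  assumes "x \<ge> 0"
  shows "x \<le> sinh x"
proof -
  have "sinh 0 - 0 \<le> sinh x - x"
  proof (rule DERIV_nonneg_imp_nondecreasing[OF assms, of "\<lambda>x. sinh x - x"])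
    fix u :: real
    have "((\<lambda>x. sinh x - x) has_real_derivative cosh u - 1) (at u)"
      by (auto intro!: derivative_eq_intros)
    then show "\<exists>y. ((\<lambda>x. sinh x - x) has_real_derivative y) (at u) \<and> 0 \<le> y"
      using cosh_real_ge_1[of u] by (intro exI[of _ "cosh u - 1"]) simp
  qed
  then show ?thesis by simp
qed

lemma sinh_diff_le:
  fixes x y :: real
  assumes "0 \<le> y"
  shows "sinh (x - y) \<le> exp (-y) * sinh x"
proof -
  have "exp (-y) * exp (-x) \<le> exp (y - x)"
    using assms by (simp flip: exp_add)
  moreover have "exp (-y) * exp x = exp (x - y)"
    by (simp flip: exp_add)
  ultimately show ?thesis
    by (simp add: sinh_def right_diff_distrib)
qed

text \<open>The \<open>CAT(-1)\<close> form of Stewart's theorem. The comparison triangle is placed with one side on the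
  imaginary axis, where the hyperbolic cosine of the distance to a fixed point is a linear combination
  of \<open>exp t\<close> and \<open>exp (-t)\<close>.\<close>

lemma CAT_stewart:
  fixes g :: "real \<Rightarrow> 'a::metric_space"
  assumes cat: "CAT_minus1 (UNIV::'a set)" and g: "isom_on dist {p..q} g" and t: "p \<le> t" "t \<le> q"
  shows "sinh (q - p) * cosh (dist c (g t))
         \<le> sinh (q - t) * cosh (dist c (g p)) + sinh (t - p) * cosh (dist c (g q))"
proof (cases "p = q")
  case True
  then show ?thesis using t by simp
next
  case False
  define a where "a = q - p"
  have a: "a > 0" using False t by (simp add: a_def)
  define G where "G s = g (p + s)" for s
  define x y where "x = g p" and "y = g q"
  have xy: "dist x y = a" using isom_onD[OF g, of p q] t by (simp add: x_def y_def a_def)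
  have G: "geoseg G x y"
    unfolding geoseg_def xy using g t by (auto simp: isom_on_def G_def x_def y_def a_def)
  have gs: "\<exists>k. geoseg k u v" for u v :: 'a
    using cat by (auto simp: CAT_minus1_def geodesic_space_def)
  obtain g2 g3 where g2: "geoseg g2 y c" and g3: "geoseg g3 c x"
    using gs by meson
  obtain z where z: "Im z > 0" "hdist z (Complex 0 (exp 0)) = dist c x"
      "hdist z (Complex 0 (exp a)) = dist c y"
    using ex_comparison_point[OF a, of "dist c x" "dist c y"] xy
      dist_triangle[of x y c] dist_triangle[of c x y] dist_triangle[of c y x]
    by (auto simp: dist_commute add.commute)
  have hsym: "hdist u v = hdist v u" for u v
    by (simp add: hdist_def norm_minus_commute mult.commute mult.left_commute)
  define k where "k s = Complex 0 (exp s)" for s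
  have kh: "k s \<in> hyp_plane" for s by (simp add: k_def hyp_plane_def)
  have kd: "hdist (k s) (k s') = \<bar>s - s'\<bar>" for s s'
    using isom_on_vertical_line[of 0] by (simp add: isom_on_def k_def)
  have zh: "z \<in> hyp_plane" using z by (simp add: hyp_plane_def)
  have hk: "hgeoseg k (k 0) (k a)"
    using kd kh a by (auto simp: hgeoseg_def isom_on_def)
  obtain h2 h3 where h2: "hgeoseg h2 (k a) z" and h3: "hgeoseg h3 z (k 0)"
    using ex_hgeoseg kh zh by meson
  have sides: "hdist (k 0) (k a) = dist x y" "hdist (k a) z = dist y c" "hdist z (k 0) = dist c x"
    using kd[of 0 a] z xy a hsym[of "k a" z] by (simp_all add: k_def dist_commute)
  have cmp: "\<forall>i<3. \<forall>j<3. \<forall>s\<in>{0..[dist x y, dist y c, dist c x] ! i}. \<forall>t\<in>{0..[dist x y, dist y c, dist c x] ! j}.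
              dist (([G, g2, g3] ! i) s) (([G, g2, g3] ! j) t) \<le> hdist (([k, h2, h3] ! i) s) (([k, h2, h3] ! j) t)"
    using cat[unfolded CAT_minus1_def Let_def, THEN conjunct2, rule_format,
        of x y c G g2 g3 "k 0" "k a" z k h2 h3] G g2 g3 kh zh sides hk h2 h3 by simp
  define s where "s = t - p"
  have s: "s \<in> {0..dist x y}" using t xy by (auto simp: s_def a_def)
  \<comment> \<open>The end of side 1 is the vertex \<open>c\<close> and side 0 is the opposite
    side: only the distance from a vertex to the opposite side is compared.\<close>
  have "dist (g2 (dist y c)) (G s) \<le> hdist (h2 (dist y c)) (k s)"
    using cmp[rule_format, of 1 0 "dist y c" s] s by simp
  moreover have "g2 (dist y c) = c" "h2 (dist y c) = z" "G s = g t"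
    using g2 h2 sides by (auto simp: geoseg_def hgeoseg_def G_def s_def)
  ultimately have "dist c (g t) \<le> hdist z (k s)" by simp
  then have "cosh (dist c (g t)) \<le> cosh (hdist z (k s))"
    by (subst cosh_real_nonneg_le_iff) (use z hdist_nonneg in \<open>auto simp: k_def\<close>)
  also have "cosh (hdist z (k r)) = ((Re z)\<^sup>2 + (Im z)\<^sup>2) / (2 * Im z) * exp (-r) + 1 / (2 * Im z) * exp r" for r
    using cosh_hdist_imaginary_axis[OF z(1), of "Re z" r] by (simp add: k_def)
  then obtain A B where AB: "\<And>r. cosh (hdist z (k r)) = A * exp (-r) + B * exp r" by blast
  finally have le: "cosh (dist c (g t)) \<le> A * exp (-s) + B * exp s" by (simp add: AB)
  have cx: "cosh (dist c x) = A + B" and cy: "cosh (dist c y) = A * exp (-a) + B * exp a"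
    using AB[of 0] AB[of a] z by (simp_all add: k_def)
  have "sinh a * cosh (dist c (g t)) \<le> sinh a * (A * exp (-s) + B * exp s)"
    using le a by simp
  also have "\<dots> = sinh (a - s) * cosh (dist c x) + sinh s * cosh (dist c y)"
    unfolding cx cy by (simp add: sinh_def exp_diff exp_minus field_simps)
  finally show ?thesis by (simp add: a_def s_def x_def y_def)
qed

context
  assumes cat: "CAT_minus1 (UNIV :: 'a::metric_space set)"
begin

text \<open>Stewart's inequality is applied twice, to \<open>g\<close> seen from \<open>g' b\<close>
  and then to \<open>g'\<close> seen from \<open>g t\<close>. In the hyperbolic plane equality
  holds: by the law of cosines both sides equal \<open>sinh a * sinh b * (sinh t)^2\<close> times
  one minus the cosine of the angle at the common origin.\<close>

lemma CAT_cosine: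
  fixes g g' :: "real \<Rightarrow> 'a"
  assumes g: "isom_on dist {0..a} g" and g': "isom_on dist {0..b} g'" and 0: "g 0 = g' 0"
    and t: "0 \<le> t" "t \<le> a" "t \<le> b"
  shows "sinh a * sinh b * (cosh (dist (g t) (g' t)) - 1)
         \<le> (sinh t)\<^sup>2 * (cosh (dist (g a) (g' b)) - cosh (a - b))"
proof -
  let ?u = "cosh (dist (g t) (g' b))" and ?z = "cosh (dist (g a) (g' b))"
  have b0: "dist (g 0) (g' b) = b" using isom_onD[OF g', of 0 b] t 0 by simp
  have t0: "dist (g t) (g' 0) = t" using isom_onD[OF g, of t 0] t 0 by simp
  have 1: "sinh a * ?u \<le> sinh (a - t) * cosh b + sinh t * ?z"
    using CAT_stewart[OF cat g, of t "g' b"] t by (simp add: b0 dist_commute)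
  have 2: "sinh b * cosh (dist (g t) (g' t)) \<le> sinh (b - t) * cosh t + sinh t * ?u"
    using CAT_stewart[OF cat g', of t "g t"] t by (simp add: t0)
  have "sinh a * (sinh b * cosh (dist (g t) (g' t))) \<le> sinh a * (sinh (b - t) * cosh t + sinh t * ?u)"
    using 2 t by (intro mult_left_mono) auto
  also have "\<dots> = sinh a * sinh (b - t) * cosh t + sinh t * (sinh a * ?u)"
    by (simp add: algebra_simps)
  also have "\<dots> \<le> sinh a * sinh (b - t) * cosh t + sinh t * (sinh (a - t) * cosh b + sinh t * ?z)"
    using 1 t by (intro add_left_mono mult_left_mono) auto
  also have "\<dots> = sinh a * sinh b + (sinh t)\<^sup>2 * (?z - cosh (a - b))"
  proof -
    have "sinh a * sinh (b - t) * cosh t + sinh t * (sinh (a - t) * cosh b + sinh t * ?z)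
        = sinh a * sinh b * (cosh t)\<^sup>2 + (sinh t)\<^sup>2 * (?z - cosh a * cosh b)"
      unfolding sinh_diff by (simp add: power2_eq_square algebra_simps)
    then show ?thesis
      unfolding cosh_square_eq cosh_diff by (simp add: algebra_simps)
  qed
  finally show ?thesis by (simp add: algebra_simps)
qed

text \<open>The case \<open>a = b = R\<close> of \<open>CAT_cosine\<close>, after writing
  \<open>cosh x - 1\<close> as twice the square of \<open>sinh (x / 2)\<close> and taking
  roots.\<close>

lemma CAT_decay:
  fixes g g' :: "real \<Rightarrow> 'a"
  assumes g: "isom_on dist {0..R} g" and g': "isom_on dist {0..R} g'" and 0: "g 0 = g' 0"
    and t: "0 \<le> t" "t \<le> R"
  shows "sinh R * sinh (dist (g t) (g' t) / 2) \<le> sinh t * sinh (dist (g R) (g' R) / 2)"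
proof -
  have "2 * (sinh R * sinh (dist (g t) (g' t) / 2))\<^sup>2 \<le> 2 * (sinh t * sinh (dist (g R) (g' R) / 2))\<^sup>2"
    using CAT_cosine[OF g g' 0 t(1,2,2)]
    by (simp add: power_mult_distrib power2_eq_square[of "sinh R"] flip: two_sinh_half_squared)
  then show ?thesis
    using t by (intro power2_le_imp_le[of "sinh R * sinh (dist (g t) (g' t) / 2)"]) auto
qed

lemma CAT_dist_mono:
  fixes g g' :: "real \<Rightarrow> 'a"
  assumes g: "isom_on dist {0..R} g" and g': "isom_on dist {0..R} g'" and 0: "g 0 = g' 0"
    and t: "0 \<le> t" "t \<le> R"
  shows "dist (g t) (g' t) \<le> dist (g R) (g' R)"
proof (cases "R = 0")
  case True
  then show ?thesis using t by simp
next
  case False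
  have "sinh t * sinh (dist (g R) (g' R) / 2) \<le> sinh R * sinh (dist (g R) (g' R) / 2)"
    using t by (intro mult_right_mono) auto
  then have "sinh R * sinh (dist (g t) (g' t) / 2) \<le> sinh R * sinh (dist (g R) (g' R) / 2)"
    using CAT_decay[OF assms] by linarith
  then show ?thesis using False t by simp
qed

text \<open>Here \<open>g' b\<close> plays the centre of a ball, and \<open>q\<close> is how much
  closer to it \<open>g\<close> has come at time \<open>m\<close>. Since the bound involves neither
  \<open>b\<close> nor \<open>m\<close>, it survives when the centres run off to infinity.\<close>

lemma CAT_dist_to_radial:
  fixes g g' :: "real \<Rightarrow> 'a"
  assumes g: "isom_on dist {0..m} g" and g': "isom_on dist {0..b} g'" and 0: "g 0 = g' 0"
    and q: "dist (g m) (g' b) \<le> b - q" and t: "0 \<le> t" "t \<le> q" and q0: "0 < q" and m0: "0 \<le> m" and b0: "0 \<le> b"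
  shows "dist (g t) (g' t) \<le> exp (t - q) / 2"
proof -
  let ?d = "dist (g t) (g' t)"
  have bm: "dist (g' b) (g 0) = b" "dist (g m) (g 0) = m"
    using isom_onD[OF g', of b 0] isom_onD[OF g, of m 0] m0 b0 0 by simp_all
  have mq: "m \<ge> q" using dist_triangle[of "g' b" "g 0" "g m"] bm q by (simp add: dist_commute)
  have bq: "b \<ge> q" using order_trans[OF zero_le_dist q] by simp
  \<comment> \<open>Half of the excess of the travelled length \<open>m\<close> over the gain
    \<open>q\<close>; it turns the difference of the two \<open>cosh\<close> terms into a product of
    \<open>sinh\<close> terms.\<close>
  define w where "w = (m - q) / 2"
  have w: "w \<ge> 0" using mq by (simp add: w_def)
  have "cosh (dist (g m) (g' b)) \<le> cosh (b - q)"
    using q bq by (subst cosh_real_nonneg_le_iff) auto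
  moreover have "cosh (b - q) - cosh (m - b) = 2 * sinh (b - q - w) * sinh w"
  proof -
    have "cosh (b - q) = cosh (b - q - w) * cosh w + sinh (b - q - w) * sinh w"
      using cosh_add[of "b - q - w" w] by simp
    moreover have "cosh (m - b) = cosh (b - q - w - w)"
      using cosh_minus[of "m - b"] by (simp add: w_def)
    ultimately show ?thesis
      using cosh_diff[of "b - q - w" w] by linarith
  qed
  ultimately have 1: "sinh m * sinh b * (cosh ?d - 1) \<le> (sinh t)\<^sup>2 * (2 * sinh (b - q - w) * sinh w)"
    by (intro order_trans[OF CAT_cosine[OF g g' 0] mult_left_mono]) (use t mq bq in auto)
  have 2: "sinh (b - q - w) \<le> exp (- (q + w)) * sinh b"
    using sinh_diff_le[of "q + w" b] q0 w by (simp add: diff_diff_eq)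
  have 3: "sinh t \<le> exp (t - m) * sinh m"
    using sinh_diff_le[of "m - t" m] t mq by simp
  have 4: "sinh t \<le> exp t / 2" by (simp add: sinh_def)
  have "(sinh t)\<^sup>2 * (2 * sinh (b - q - w) * sinh w)
      \<le> (sinh t)\<^sup>2 * (2 * (exp (- (q + w)) * sinh b) * sinh w)"
    by (intro mult_left_mono mult_right_mono 2) (use w in auto)
  also have "(sinh t)\<^sup>2 \<le> (exp (t - m) * sinh m) * (exp t / 2)"
    unfolding power2_eq_square using 3 4 t mq by (intro mult_mono) auto
  then have "(sinh t)\<^sup>2 * (2 * (exp (- (q + w)) * sinh b) * sinh w)
      \<le> ((exp (t - m) * sinh m) * (exp t / 2)) * (2 * (exp (- (q + w)) * sinh b) * sinh w)"
    by (rule mult_right_mono) (use w bq q0 in auto)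
  also have "\<dots> = sinh m * sinh b * (exp (t - m) * exp t * exp (- (q + w)) * sinh w)"
    by (simp add: mult_ac)
  finally have "sinh m * sinh b * (cosh ?d - 1)
      \<le> sinh m * sinh b * (exp (t - m) * exp t * exp (- (q + w)) * sinh w)"
    using 1 by linarith
  then have "cosh ?d - 1 \<le> exp (t - m) * exp t * exp (- (q + w)) * sinh w"
    using mq bq q0 by simp
  also have "\<dots> = (exp (t - q))\<^sup>2 * (exp (- (2 * w)) - (exp (- (2 * w)))\<^sup>2) / 2"
  proof -
    have m: "m = q + 2 * w" by (simp add: w_def field_simps)
    have "exp (t - m) * exp t * exp (- (q + w)) = exp (t - q) * exp (t - q) * exp (- (3 * w))"
      by (simp add: m flip: exp_add)
    moreover have "exp (- (3 * w)) * exp w = exp (- (2 * w))"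
      "exp (- (3 * w)) * exp (- w) = exp (- (2 * w)) * exp (- (2 * w))"
      by (simp_all flip: exp_add)
    ultimately show ?thesis
      by (simp add: sinh_def power2_eq_square right_diff_distrib mult.assoc)
  qed
  \<comment> \<open>With \<open>y = exp (-2 w)\<close> the dependence on the excess is
    \<open>y - y^2\<close>, whose maximum is \<open>1/4\<close>; this produces the factor
    \<open>1/2\<close> of the final bound.\<close>
  also have "\<dots> \<le> (exp (t - q))\<^sup>2 * (1 / 4) / 2"
  proof -
    have "y - y\<^sup>2 \<le> 1 / 4" for y :: real
      using zero_le_power2[of "y - 1 / 2"] by (simp add: power2_eq_square algebra_simps)
    then show ?thesis by (intro divide_right_mono mult_left_mono) auto
  qed
  finally have "(sinh (?d / 2))\<^sup>2 \<le> (exp (t - q) / 4)\<^sup>2"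
    using two_sinh_half_squared[of ?d] by (simp add: power_divide)
  then have "sinh (?d / 2) \<le> exp (t - q) / 4"
    by (rule power2_le_imp_le) simp
  then show ?thesis
    using sinh_ge_self[of "?d / 2"] by simp
qed

end

section \<open>Limits of geodesics\<close>

text \<open>By Tychonoff's theorem the functions have a cluster point in the product topology. The
  index set may be uncountable, so no convergent subsequence is claimed: the approximation holds
  frequently, simultaneously at finitely many arguments.\<close>

lemma ex_cluster_function:
  fixes f :: "nat \<Rightarrow> 'b \<Rightarrow> 'a::metric_space"
  assumes S: "\<And>t. compact (S t)" and f: "\<And>n t. f n t \<in> S t"
  shows "\<exists>g. \<forall>T e. finite T \<longrightarrow> e > 0 \<longrightarrow> (\<exists>\<^sub>F n in sequentially. \<forall>t\<in>T. dist (f n t) (g t) < e)"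
proof -
  have "compactin (product_topology (\<lambda>_. euclidean) UNIV) (PiE UNIV S)"
    unfolding compactin_PiE using S by simp
  then have K: "compact (PiE UNIV S)"
    by (simp add: euclidean_product_topology)
  define C where "C N = closure (f ` {N..})" for N
  have "PiE UNIV S \<inter> \<Inter>(range C) \<noteq> {}"
  proof (rule compact_imp_fip[OF K])
    fix F' assume F': "finite F'" "F' \<subseteq> range C"
    then obtain I where I: "finite I" "F' = C ` I"
      by (meson finite_subset_image)
    define N where "N = Max (insert 0 I)"
    have "f N \<in> C i" if "i \<in> I" for i
      unfolding C_def using I(1) that closure_subset[of "f ` {i..}"]
      by (auto simp: N_def intro!: subsetD[OF closure_subset])
    then have "f N \<in> PiE UNIV S \<inter> \<Inter>F'"
      using I f by auto
    then show "PiE UNIV S \<inter> \<Inter>F' \<noteq> {}" by blast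
  qed (auto simp: C_def)
  then obtain g where g: "\<And>N. g \<in> closure (f ` {N..})"
    by (auto simp: C_def)
  have "\<exists>\<^sub>F n in sequentially. \<forall>t\<in>T. dist (f n t) (g t) < e" if T: "finite T" and e: "e > 0" for T e
    unfolding frequently_sequentially
  proof
    fix N
    define U where "U = (\<Inter>t\<in>T. {k. dist (k t) (g t) < e})"
    have "open {k :: 'b \<Rightarrow> 'a. dist (k t) (g t) < e}" for t
      by (intro open_Collect_less continuous_intros continuous_on_dist continuous_on_product_coordinates)
    then have "open U" unfolding U_def using T by blast
    moreover have "g \<in> U" using e by (auto simp: U_def)
    ultimately have "U \<inter> f ` {N..} \<noteq> {}"
      using g[of N] open_Int_closure_eq_empty[of U "f ` {N..}"] by blast
    then show "\<exists>n\<ge>N. \<forall>t\<in>T. dist (f n t) (g t) < e"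
      by (auto simp: U_def)
  qed
  then show ?thesis by blast
qed

text \<open>Simultaneous approximation at two arguments transfers \<open>\<bar>s - t\<bar>\<close>
  to the cluster point. The hypotheses are only eventual because the approximating geodesics may be
  defined on growing intervals.\<close>

lemma ex_cluster_isometry:
  fixes f :: "nat \<Rightarrow> real \<Rightarrow> 'a::metric_space"
  assumes proper: "proper_mspace (UNIV :: 'a set)"
    and bdd: "\<And>t. t \<in> I \<Longrightarrow> \<exists>y r. \<forall>\<^sub>F n in sequentially. dist y (f n t) \<le> r"
    and isom: "\<And>s t. s \<in> I \<Longrightarrow> t \<in> I \<Longrightarrow> \<forall>\<^sub>F n in sequentially. dist (f n s) (f n t) = \<bar>s - t\<bar>"
  shows "\<exists>g. isom_on dist I g \<and> (\<forall>t\<in>I. \<forall>e>0. \<exists>\<^sub>F n in sequentially. dist (f n t) (g t) < e)"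
proof -
  obtain y r where yr: "\<And>t. t \<in> I \<Longrightarrow> \<forall>\<^sub>F n in sequentially. dist (y t) (f n t) \<le> r t"
    using bdd by metis
  \<comment> \<open>Finitely many terms may violate the bound at \<open>t\<close>; there the default
    value \<open>y t\<close> keeps the function inside a compact set.\<close>
  define f' where "f' n t = (if dist (y t) (f n t) \<le> r t then f n t else y t)" for n t
  have S: "compact (insert (y t) (cball (y t) (r t)))" for t
    using proper by (simp add: proper_mspace_def)
  have "f' n t \<in> insert (y t) (cball (y t) (r t))" for n t
    by (simp add: f'_def)
  then obtain g where g: "\<And>T e. finite T \<Longrightarrow> e > 0 \<Longrightarrow> \<exists>\<^sub>F n in sequentially. \<forall>t\<in>T. dist (f' n t) (g t) < e"
    using ex_cluster_function[of "\<lambda>t. insert (y t) (cball (y t) (r t))" f', OF S] by blast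
  have ff': "\<forall>\<^sub>F n in sequentially. f' n t = f n t" if "t \<in> I" for t
    using yr[OF that] by eventually_elim (simp add: f'_def)
  have 1: "\<exists>\<^sub>F n in sequentially. dist (f n t) (g t) < e" if "t \<in> I" "e > 0" for t e
  proof -
    have "\<exists>\<^sub>F n in sequentially. dist (f' n t) (g t) < e"
      using g[of "{t}" e] that by simp
    then show ?thesis
      by (rule frequently_rev_mp) (use ff'[OF that(1)] in \<open>auto elim: eventually_mono\<close>)
  qed
  have "dist (g s) (g t) = \<bar>s - t\<bar>" if st: "s \<in> I" "t \<in> I" for s t
  proof -
    have *: "\<bar>dist (g s) (g t) - \<bar>s - t\<bar>\<bar> \<le> 2 * e" if e: "e > 0" for e
    proof -
      have "\<exists>\<^sub>F n in sequentially. \<forall>u\<in>{s,t}. dist (f' n u) (g u) < e"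
        using g[of "{s,t}" e] e by blast
      moreover have "\<forall>\<^sub>F n in sequentially. f' n s = f n s \<and> f' n t = f n t \<and> dist (f n s) (f n t) = \<bar>s - t\<bar>"
        using ff'[OF st(1)] ff'[OF st(2)] isom[OF st] by eventually_elim simp
      ultimately have "\<exists>\<^sub>F n in sequentially. dist (f n s) (g s) < e \<and> dist (f n t) (g t) < e \<and>
          dist (f n s) (f n t) = \<bar>s - t\<bar>"
        by (rule frequently_rev_mp[OF _ eventually_mono]) auto
      then obtain n where n: "dist (f n s) (g s) < e" "dist (f n t) (g t) < e" "dist (f n s) (f n t) = \<bar>s - t\<bar>"
        by (auto dest: frequently_ex)
      then show ?thesis
        using dist_triangle[of "g s" "g t" "f n s"] dist_triangle[of "f n s" "g t" "f n t"]
          dist_triangle[of "f n s" "f n t" "g s"] dist_triangle[of "g s" "f n t" "g t"]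
        by (simp add: dist_commute)
    qed
    have "\<bar>dist (g s) (g t) - \<bar>s - t\<bar>\<bar> \<le> 0"
    proof (rule field_le_epsilon)
      fix e :: real assume "e > 0"
      then show "\<bar>dist (g s) (g t) - \<bar>s - t\<bar>\<bar> \<le> 0 + e" using *[of "e / 2"] by simp
    qed
    then show ?thesis by simp
  qed
  then show ?thesis using 1 by (intro exI[of _ g]) (auto simp: isom_on_def)
qed

lemma closed_cluster:
  fixes f :: "nat \<Rightarrow> 'a::metric_space"
  assumes "closed P" "\<forall>\<^sub>F n in sequentially. f n \<in> P" "\<And>e. e > 0 \<Longrightarrow> \<exists>\<^sub>F n in sequentially. dist (f n) y < e"
  shows "y \<in> P"
proof -
  have "\<exists>z\<in>P. dist z y < e" if "e > 0" for e
    using frequently_ex[OF frequently_eventually_frequently[OF assms(3)[OF that] assms(2)]] by blast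
  then show ?thesis
    using assms(1) closure_approachable[of y P] by simp
qed

section \<open>Depth functions\<close>

text \<open>Constant sequences give balls, centres running along a ray give horoballs. Inequalities
  for distances to a point that are stable under limits thus need to be proved only once.\<close>

definition depth_fun :: "('a::metric_space \<Rightarrow> real) \<Rightarrow> bool" where
  "depth_fun h \<longleftrightarrow> (\<exists>c r. \<forall>y. (\<lambda>n. r n - dist (c n) y) \<longlonglongrightarrow> h y)"

lemma depth_fun_lipschitz:
  assumes "depth_fun h"
  shows "h y \<le> h z + dist y z"
proof -
  obtain c r where cr: "\<And>y. (\<lambda>n. r n - dist (c n) y) \<longlonglongrightarrow> h y"
    using assms by (auto simp: depth_fun_def)
  have "(\<lambda>n. r n - dist (c n) z + dist y z) \<longlonglongrightarrow> h z + dist y z"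
    by (intro tendsto_intros cr)
  from LIMSEQ_le[OF cr[of y] this] show ?thesis
    using dist_triangle[of _ z y] by (force simp: algebra_simps)
qed

lemma depth_fun_continuous:
  assumes "depth_fun h"
  shows "continuous_on UNIV h"
proof -
  have "1-lipschitz_on UNIV h"
    using depth_fun_lipschitz[OF assms]
    by (intro lipschitz_onI) (auto simp: dist_real_def abs_le_iff algebra_simps, metis dist_commute)
  then show ?thesis by (rule lipschitz_on_continuous_on)
qed

context
  assumes cat: "CAT_minus1 (UNIV :: 'a::metric_space set)"
begin

text \<open>Follows from Stewart's inequality, because \<open>sinh\<close> is superadditive on
  nonnegative reals.\<close>

lemma CAT_dist_quasiconvex:
  fixes g :: "real \<Rightarrow> 'a"
  assumes g: "isom_on dist {p..q} g" and t: "p \<le> t" "t \<le> q"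
  shows "dist c (g t) \<le> max (dist c (g p)) (dist c (g q))"
proof (cases "p = q")
  case True
  then show ?thesis using t by simp
next
  case False
  define M where "M = max (dist c (g p)) (dist c (g q))"
  have M0: "0 \<le> M" by (simp add: M_def le_max_iff_disj)
  have M: "cosh (dist c (g p)) \<le> cosh M" "cosh (dist c (g q)) \<le> cosh M"
    using M0 by (simp_all add: cosh_real_nonneg_le_iff M_def)
  have "sinh (q - t) * 1 + 1 * sinh (t - p) \<le> sinh (q - t) * cosh (t - p) + cosh (q - t) * sinh (t - p)"
    using t cosh_real_ge_1 by (intro add_mono mult_mono) auto
  then have s: "sinh (q - t) + sinh (t - p) \<le> sinh (q - p)"
    using sinh_add[of "q - t" "t - p"] by simp
  have "sinh (q - p) * cosh (dist c (g t)) \<le> sinh (q - t) * cosh M + sinh (t - p) * cosh M"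
    using CAT_stewart[OF cat g t, of c] M t
    by (smt (verit) mult_left_mono sinh_real_nonneg_iff)
  also have "\<dots> \<le> sinh (q - p) * cosh M"
    using s by (simp add: mult_right_mono flip: distrib_right)
  finally have "cosh (dist c (g t)) \<le> cosh M"
    using False t by simp
  then have "dist c (g t) \<le> M"
    using M0 by (simp add: cosh_real_nonneg_le_iff)
  then show ?thesis by (simp add: M_def)
qed

text \<open>At the midpoint Stewart's inequality becomes
  \<open>cosh l * cosh D \<le> cosh M\<close>, which forces \<open>cosh l \<le> exp (M - D)\<close>.
  The term \<open>ln 2\<close> comes from \<open>exp l / 2 \<le> cosh l\<close>.\<close>

lemma CAT_dist_midpoint:
  fixes g :: "real \<Rightarrow> 'a"
  assumes g: "isom_on dist {p..q} g" and pq: "p \<le> q"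
  shows "dist c (g ((p + q) / 2)) \<le> max (dist c (g p)) (dist c (g q)) - ((q - p) / 2 - ln 2)"
proof (cases "p = q")
  case True
  then show ?thesis by simp
next
  case False
  define M where "M = max (dist c (g p)) (dist c (g q))"
  define D l where "D = dist c (g ((p + q) / 2))" and "l = (q - p) / 2"
  have l: "l > 0" using False pq by (simp add: l_def)
  have M: "cosh (dist c (g p)) \<le> cosh M" "cosh (dist c (g q)) \<le> cosh M"
    by (simp_all add: cosh_real_nonneg_le_iff M_def le_max_iff_disj)
  have DM: "D \<le> M" unfolding D_def M_def by (rule CAT_dist_quasiconvex[OF g]) (use pq in auto)
  have e: "q - (p + q) / 2 = l" "(p + q) / 2 - p = l" "q - p = 2 * l" by (simp_all add: l_def field_simps)
  have "sinh (2 * l) * cosh D \<le> sinh l * cosh (dist c (g p)) + sinh l * cosh (dist c (g q))"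
    using CAT_stewart[OF cat g, of "(p + q) / 2" c] pq unfolding e D_def by simp
  also have "\<dots> \<le> sinh l * cosh M + sinh l * cosh M"
    using M l by (intro add_mono mult_left_mono) auto
  finally have "sinh l * (cosh l * cosh D) \<le> sinh l * cosh M"
    unfolding sinh_double by (simp add: mult_ac)
  then have 1: "cosh l * cosh D \<le> cosh M" using l by simp
  have "cosh M \<le> exp (M - D) * cosh D"
  proof -
    have "exp (- M) \<le> exp (M - D) * exp (- D)"
      using DM by (simp flip: exp_add)
    moreover have "exp M = exp (M - D) * exp D" by (simp flip: exp_add)
    ultimately show ?thesis by (simp add: cosh_def distrib_left)
  qed
  then have "cosh l * cosh D \<le> exp (M - D) * cosh D" using 1 by linarith
  then have "cosh l \<le> exp (M - D)" by simp
  moreover have "exp l / 2 \<le> cosh l" by (simp add: cosh_def)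
  ultimately have "exp l / 2 \<le> exp (M - D)" by linarith
  moreover have "exp (l - ln 2) = exp l / 2" by (simp add: exp_diff)
  ultimately have "exp (l - ln 2) \<le> exp (M - D)" by linarith
  then show ?thesis by (simp add: M_def D_def l_def)
qed

text \<open>This bounds the time that a geodesic can spend inside a region without becoming
  deep.\<close>

lemma depth_fun_midpoint:
  fixes g :: "real \<Rightarrow> 'a"
  assumes h: "depth_fun h" and g: "isom_on dist {p..q} g" and pq: "p \<le> q"
  shows "min (h (g p)) (h (g q)) + ((q - p) / 2 - ln 2) \<le> h (g ((p + q) / 2))"
proof -
  obtain c r where cr: "\<And>y. (\<lambda>n. r n - dist (c n) y) \<longlonglongrightarrow> h y"
    using h by (auto simp: depth_fun_def)
  have "(\<lambda>n. min (r n - dist (c n) (g p)) (r n - dist (c n) (g q)) + ((q - p) / 2 - ln 2))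
      \<longlonglongrightarrow> min (h (g p)) (h (g q)) + ((q - p) / 2 - ln 2)"
    by (intro tendsto_intros tendsto_min cr)
  moreover have "min (r n - dist (c n) (g p)) (r n - dist (c n) (g q)) + ((q - p) / 2 - ln 2)
      \<le> r n - dist (c n) (g ((p + q) / 2))" for n
    using CAT_dist_midpoint[OF g pq, of "c n"] by linarith
  ultimately show ?thesis
    using LIMSEQ_le[OF _ cr] by blast
qed

lemma depth_fun_quasiconcave:
  fixes g :: "real \<Rightarrow> 'a"
  assumes h: "depth_fun h" and g: "isom_on dist {p..q} g" and t: "p \<le> t" "t \<le> q"
  shows "min (h (g p)) (h (g q)) \<le> h (g t)"
proof -
  obtain c r where cr: "\<And>y. (\<lambda>n. r n - dist (c n) y) \<longlonglongrightarrow> h y"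
    using h by (auto simp: depth_fun_def)
  have "(\<lambda>n. min (r n - dist (c n) (g p)) (r n - dist (c n) (g q))) \<longlonglongrightarrow> min (h (g p)) (h (g q))"
    by (intro tendsto_intros tendsto_min cr)
  moreover have "min (r n - dist (c n) (g p)) (r n - dist (c n) (g q)) \<le> r n - dist (c n) (g t)" for n
    using CAT_dist_quasiconvex[OF g t, of "c n"] by linarith
  ultimately show ?thesis
    using LIMSEQ_le[OF _ cr] by blast
qed

text \<open>For large \<open>n\<close> the gain of depth \<open>q\<close> is, up to
  \<open>e\<close>, a gain in distance to \<open>c n\<close>, so \<open>CAT_dist_to_radial\<close>
  applies to the segment towards \<open>c n\<close>.\<close>

lemma depth_fun_radial:
  fixes g :: "real \<Rightarrow> 'a"
  assumes cr: "\<And>y. (\<lambda>n. r n - dist (c n) y) \<longlonglongrightarrow> h y"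
    and g: "isom_on dist {0..m} g" and m: "0 \<le> m" and q: "q \<le> h (g m) - h (g 0)"
    and t: "0 \<le> t" "t + e < q" and e: "e > 0"
  shows "\<forall>\<^sub>F n in sequentially. \<forall>\<sigma>. geoseg \<sigma> (g 0) (c n) \<longrightarrow>
           t \<le> dist (g 0) (c n) \<and> dist (g t) (\<sigma> t) \<le> exp (t - q + e) / 2"
proof -
  have "(\<lambda>n. (r n - dist (c n) (g m)) - (r n - dist (c n) (g 0))) \<longlonglongrightarrow> h (g m) - h (g 0)"
    by (intro tendsto_intros cr)
  then have "\<forall>\<^sub>F n in sequentially. q - e < (r n - dist (c n) (g m)) - (r n - dist (c n) (g 0))"
    by (rule order_tendstoD) (use q e in auto)
  then show ?thesis
  proof eventually_elim
    case (elim n)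
    show ?case
    proof (intro allI impI)
      fix \<sigma> assume \<sigma>: "geoseg \<sigma> (g 0) (c n)"
      let ?b = "dist (g 0) (c n)"
      have le: "dist (g m) (c n) \<le> ?b - (q - e)"
        using elim by (simp add: dist_commute)
      have "dist (g t) (\<sigma> t) \<le> exp (t - (q - e)) / 2"
        by (rule CAT_dist_to_radial[OF cat g, where b = ?b])
           (use \<sigma> le t m e in \<open>auto simp: geoseg_def\<close>)
      then show "t \<le> ?b \<and> dist (g t) (\<sigma> t) \<le> exp (t - q + e) / 2"
        using order_trans[OF zero_le_dist le] t by (simp add: algebra_simps)
    qed
  qed
qed

lemma ex_geoseg: "\<exists>\<sigma>. geoseg \<sigma> x (y::'a)"
  using cat by (auto simp: CAT_minus1_def geodesic_space_def)

lemma eventually_at_right_small: "q > t \<Longrightarrow> \<forall>\<^sub>F e in at_right 0. 0 < e \<and> t + e < (q::real)"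
  using eventually_at_right_real[of 0 "q - t"] by (auto elim: eventually_mono)

text \<open>Both geodesics are compared with one segment towards \<open>c n\<close>; each
  contributes half of the bound, and the slack \<open>e\<close> tends to 0.\<close>

lemma depth_fun_close:
  fixes g g' :: "real \<Rightarrow> 'a"
  assumes h: "depth_fun h"
    and g: "isom_on dist {0..m} g" and m: "0 \<le> m" and q: "q \<le> h (g m) - h (g 0)"
    and g': "isom_on dist {0..m'} g'" and m': "0 \<le> m'" and q': "q \<le> h (g' m') - h (g 0)"
    and 0: "g' 0 = g 0" and t: "0 \<le> t" "t < q"
  shows "dist (g t) (g' t) \<le> exp (t - q)"
proof -
  obtain c r where cr: "\<And>y. (\<lambda>n. r n - dist (c n) y) \<longlonglongrightarrow> h y"
    using h by (auto simp: depth_fun_def)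
  have "((\<lambda>e. exp (t - q + e)) \<longlongrightarrow> exp (t - q + 0)) (at_right 0)"
    by (intro tendsto_intros)
  moreover have "\<forall>\<^sub>F e in at_right 0. dist (g t) (g' t) \<le> exp (t - q + e)"
    using eventually_at_right_small[OF t(2)]
  proof eventually_elim
    case (elim e)
    then have e: "t + e < q" "0 < e" by auto
    have q'': "q \<le> h (g' m') - h (g' 0)" using q' 0 by simp
    have "\<forall>\<^sub>F n in sequentially. dist (g t) (g' t) \<le> exp (t - q + e)"
      using depth_fun_radial[OF cr g m q t(1) e] depth_fun_radial[OF cr g' m' q'' t(1) e]
    proof eventually_elim
      case (elim n)
      obtain \<sigma> where "geoseg \<sigma> (g 0) (c n)" using ex_geoseg by blast
      then show ?case
        using elim(1,2) 0 dist_triangle2[of "g t" "g' t" "\<sigma> t"] by fastforce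
    qed
    then show ?case by simp
  qed
  ultimately show ?thesis
    using tendsto_lowerbound[of "\<lambda>e. exp (t - q + e)" "exp (t - q)" "at_right 0"] by simp
qed

text \<open>Depth grows at unit speed along the segment towards the centre, and a geodesic that
  later gains depth \<open>q\<close> stays close to this segment.\<close>

lemma depth_fun_entry:
  fixes g :: "real \<Rightarrow> 'a"
  assumes h: "depth_fun h"
    and g: "isom_on dist {0..m} g" and m: "0 \<le> m" and q: "q \<le> h (g m) - h (g 0)"
    and t: "0 \<le> t" "t < q"
  shows "h (g 0) + t - exp (t - q) / 2 \<le> h (g t)"
proof -
  obtain c r where cr: "\<And>y. (\<lambda>n. r n - dist (c n) y) \<longlonglongrightarrow> h y"
    using h by (auto simp: depth_fun_def)
  have "((\<lambda>e. h (g t) + exp (t - q + e) / 2) \<longlongrightarrow> h (g t) + exp (t - q + 0) / 2) (at_right 0)"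
    by (intro tendsto_intros) auto
  moreover have "\<forall>\<^sub>F e in at_right 0. h (g 0) + t \<le> h (g t) + exp (t - q + e) / 2"
    using eventually_at_right_small[OF t(2)]
  proof eventually_elim
    case (elim e)
    then have e: "t + e < q" "0 < e" by auto
    have "\<forall>\<^sub>F n in sequentially. r n - dist (c n) (g 0) + t \<le> r n - dist (c n) (g t) + exp (t - q + e) / 2"
      using depth_fun_radial[OF cr g m q t(1) e]
    proof eventually_elim
      case (elim n)
      obtain \<sigma> where \<sigma>: "geoseg \<sigma> (g 0) (c n)" using ex_geoseg by blast
      then have *: "t \<le> dist (g 0) (c n)" "dist (g t) (\<sigma> t) \<le> exp (t - q + e) / 2"
        using elim by auto
      have "dist (\<sigma> t) (c n) = dist (g 0) (c n) - t"
        using isom_onD[of dist "{0..dist (g 0) (c n)}" \<sigma> t "dist (g 0) (c n)"] \<sigma> * t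
        by (auto simp: geoseg_def)
      then show ?case
        using * dist_triangle[of "c n" "g t" "\<sigma> t"] by (simp add: dist_commute)
    qed
    moreover have "(\<lambda>n. r n - dist (c n) (g 0) + t) \<longlonglongrightarrow> h (g 0) + t"
      "(\<lambda>n. r n - dist (c n) (g t) + exp (t - q + e) / 2) \<longlonglongrightarrow> h (g t) + exp (t - q + e) / 2"
      by (intro tendsto_add cr tendsto_const)+
    ultimately show ?case
      by (intro tendsto_le[OF sequentially_bot])
  qed
  ultimately have "h (g 0) + t \<le> h (g t) + exp (t - q + 0) / 2"
    by (rule tendsto_lowerbound) simp
  then show ?thesis by simp
qed

end

section \<open>Rays with prescribed end or prescribed depth\<close>

lemma geo_ray_isom_on: "geo_ray \<rho> \<Longrightarrow> isom_on dist {0..m} \<rho>"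
  unfolding geo_ray_def by (erule isom_on_subset) auto

lemma geo_ray_dist: "geo_ray \<rho> \<Longrightarrow> 0 \<le> s \<Longrightarrow> 0 \<le> t \<Longrightarrow> dist (\<rho> s) (\<rho> t) = \<bar>s - t\<bar>"
  by (simp add: geo_ray_def isom_on_def)

lemma asymptotic_trans: "asymptotic f g \<Longrightarrow> asymptotic g k \<Longrightarrow> asymptotic f k"
  unfolding asymptotic_def by (meson add_mono dist_triangle order_trans)

lemma asymptotic_sym: "asymptotic f g \<Longrightarrow> asymptotic g f"
  unfolding asymptotic_def by (simp add: dist_commute)

lemma bdry_memD: "\<xi> \<in> bdry \<Longrightarrow> \<rho> \<in> \<xi> \<Longrightarrow> geo_ray \<rho>"
  by (auto simp: bdry_def)

lemma bdry_mem_iff: "\<xi> \<in> bdry \<Longrightarrow> \<rho> \<in> \<xi> \<Longrightarrow> \<rho>' \<in> \<xi> \<longleftrightarrow> geo_ray \<rho>' \<and> asymptotic \<rho> \<rho>'"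
  unfolding bdry_def using asymptotic_trans asymptotic_sym by blast

lemma bdry_nonempty: "\<xi> \<in> bdry \<Longrightarrow> \<exists>\<rho>. \<rho> \<in> \<xi>"
  unfolding bdry_def asymptotic_def by force

text \<open>The segment from \<open>c n\<close> to \<open>x\<close> is extended beyond
  \<open>x\<close>; along the extension the distance to \<open>c n\<close> grows. A cluster point of
  these rays works for the limit \<open>h\<close>. It serves as the harmless end of the path in the
  boundary.\<close>

lemma ex_ray_decreasing_depth:
  fixes x :: "'a::metric_space"
  assumes cat: "CAT_minus1 (UNIV :: 'a set)"
    and proper: "proper_mspace (UNIV :: 'a set)" and ext: "extendible_geodesics (UNIV :: 'a set)"
    and h: "depth_fun h"
  shows "\<exists>\<rho>. geo_ray \<rho> \<and> \<rho> 0 = x \<and> (\<forall>t\<ge>0. h (\<rho> t) \<le> h x)"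
proof -
  obtain c r where cr: "\<And>y. (\<lambda>n. r n - dist (c n) y) \<longlonglongrightarrow> h y"
    using h by (auto simp: depth_fun_def)
  have "\<exists>f. geo_ray f \<and> f 0 = x \<and> (\<forall>t\<ge>0. dist y (f t) = dist y x + t)" for y
  proof -
    obtain \<sigma> where \<sigma>: "geoseg \<sigma> y x" using ex_geoseg[OF cat] by blast
    then obtain l where l: "geo_line l" "\<forall>t\<in>{0..dist y x}. l t = \<sigma> t"
      using ext unfolding extendible_geodesics_def geoseg_def by (metis subset_UNIV zero_le_dist)
    have ld: "dist (l s) (l t) = \<bar>s - t\<bar>" for s t using l by (simp add: geo_line_def isom_on_def)
    have ly: "l 0 = y" "l (dist y x) = x" using l \<sigma> by (auto simp: geoseg_def)
    have "dist y (l (dist y x + t)) = dist y x + t" if "t \<ge> 0" for t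
      using ld[of 0 "dist y x + t"] that zero_le_dist[of y x] unfolding ly(1) by linarith
    then show ?thesis
      using ld ly by (intro exI[of _ "\<lambda>t. l (dist y x + t)"]) (auto simp: geo_ray_def isom_on_def)
  qed
  then obtain F where F: "\<And>y. geo_ray (F y)" "\<And>y. F y 0 = x"
      "\<And>y t. t \<ge> 0 \<Longrightarrow> dist y (F y t) = dist y x + t"
    by metis
  define f where "f n = F (c n)" for n
  have "\<exists>g. isom_on dist {0..} g \<and> (\<forall>t\<in>{0..}. \<forall>e>0. \<exists>\<^sub>F n in sequentially. dist (f n t) (g t) < e)"
  proof (rule ex_cluster_isometry[OF proper])
    show "\<exists>y r. \<forall>\<^sub>F n in sequentially. dist y (f n t) \<le> r" if "t \<in> {0..}" for t
      using geo_ray_dist[OF F(1), of 0 t] F(2) that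
      by (intro exI[of _ x] exI[of _ t]) (simp add: f_def)
  qed (use F(1) in \<open>auto simp: f_def geo_ray_dist\<close>)
  then obtain g where g: "isom_on dist {0..} g"
      "\<And>t e. t \<ge> 0 \<Longrightarrow> e > 0 \<Longrightarrow> \<exists>\<^sub>F n in sequentially. dist (f n t) (g t) < e"
    by auto
  have "h (g t) \<le> h x" if t: "t \<ge> 0" for t
  proof (rule ccontr)
    assume neg: "\<not> ?thesis"
    define e where "e = (h (g t) - h x) / 2"
    have e: "e > 0" using neg by (simp add: e_def)
    have "(\<lambda>n. (r n - dist (c n) (g t)) - (r n - dist (c n) x)) \<longlonglongrightarrow> h (g t) - h x"
      by (intro tendsto_intros cr)
    then have "\<forall>\<^sub>F n in sequentially. e < (r n - dist (c n) (g t)) - (r n - dist (c n) x)"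
      by (rule order_tendstoD) (use e in \<open>simp add: e_def\<close>)
    then obtain n where n: "dist (f n t) (g t) < e" "dist (c n) (g t) + e < dist (c n) x"
      using frequently_ex[OF frequently_eventually_frequently[OF g(2)[OF t e]]] by fastforce
    moreover have "dist (c n) (f n t) = dist (c n) x + t" using F(3)[OF t] by (simp add: f_def)
    ultimately show False
      using dist_triangle[of "c n" "f n t" "g t"] t by (simp add: dist_commute)
  qed
  moreover have "g 0 = x"
    using closed_cluster[of "{x}" "\<lambda>n. f n 0" "g 0"] g(2)[of 0] F(2) by (simp add: f_def)
  ultimately show ?thesis using g(1) by (auto simp: geo_ray_def)
qed

text \<open>Seen from the common end \<open>\<rho> R\<close>, points at equal distance from this end
  are at most \<open>dist x (\<rho> 0)\<close> apart, and matching the parameters costs at most the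
  same again. The factor 3 is needed for small \<open>t\<close>, where no such point exists on the
  ray and the path through \<open>x\<close> and \<open>\<rho> 0\<close> is used.\<close>

lemma CAT_dist_segment_ray:
  fixes \<rho> :: "real \<Rightarrow> 'a::metric_space"
  assumes cat: "CAT_minus1 (UNIV :: 'a set)"
    and \<rho>: "geo_ray \<rho>" and \<sigma>: "geoseg \<sigma> x (\<rho> R)" and R: "R \<ge> 0" and t: "0 \<le> t" "t \<le> dist x (\<rho> R)"
  shows "dist (\<sigma> t) (\<rho> t) \<le> 3 * dist x (\<rho> 0)"
proof -
  define L d where "L = dist x (\<rho> R)" and "d = dist x (\<rho> 0)"
  have \<sigma>': "isom_on dist {0..L} \<sigma>" "\<sigma> 0 = x" "\<sigma> L = \<rho> R"
    using \<sigma> by (auto simp: geoseg_def L_def)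
  have RL: "\<bar>R - L\<bar> \<le> d"
    using dist_triangle[of x "\<rho> R" "\<rho> 0"] dist_triangle[of "\<rho> 0" "\<rho> R" x] geo_ray_dist[OF \<rho>, of 0 R] R
    by (simp add: L_def d_def dist_commute abs_le_iff)
  show ?thesis
  proof (cases "L - t \<le> R")
    case False
    then have "t \<le> d" using RL by linarith
    moreover have "dist (\<sigma> t) x = t" using isom_onD[OF \<sigma>'(1), of t 0] \<sigma>' t by (simp add: L_def)
    moreover have "dist (\<rho> 0) (\<rho> t) = t" using geo_ray_dist[OF \<rho>, of 0 t] t by simp
    ultimately show ?thesis
      using dist_triangle[of "\<sigma> t" "\<rho> t" x] dist_triangle[of x "\<rho> t" "\<rho> 0"] by (simp add: d_def)
  next
    case True
    define s where "s = L - t"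
    have s: "0 \<le> s" "s \<le> L" "s \<le> R" using t True by (auto simp: s_def L_def)
    have "dist (\<sigma> (L - s)) (\<rho> (R - s)) \<le> d"
    proof (cases "s = 0")
      case True
      then show ?thesis using \<sigma>' by (simp add: d_def)
    next
      case False
      then have pos: "sinh L * sinh R > 0" using s by simp
      have 1: "sinh L * sinh R * (cosh (dist (\<sigma> (L - s)) (\<rho> (R - s))) - 1)
            \<le> (sinh s)\<^sup>2 * (cosh (dist (\<sigma> (L - L)) (\<rho> (R - R))) - cosh (L - R))"
        by (rule CAT_cosine[OF cat])
           (use \<sigma>' \<rho> s in \<open>auto simp: isom_on_def geo_ray_dist\<close>)
      have d1: "cosh d - 1 \<ge> 0" using cosh_real_ge_1[of d] by simp
      have "(sinh s)\<^sup>2 * (cosh d - cosh (L - R)) \<le> (sinh s)\<^sup>2 * (cosh d - 1)"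
        using cosh_real_ge_1[of "L - R"] by (intro mult_left_mono) auto
      also have "\<dots> \<le> (sinh L * sinh R) * (cosh d - 1)"
        unfolding power2_eq_square using s d1 by (intro mult_right_mono mult_mono) auto
      finally have "(sinh L * sinh R) * (cosh (dist (\<sigma> (L - s)) (\<rho> (R - s))) - 1)
          \<le> (sinh L * sinh R) * (cosh d - 1)"
        using 1 \<sigma>'(2) by (simp add: d_def)
      then have "cosh (dist (\<sigma> (L - s)) (\<rho> (R - s))) \<le> cosh d"
        unfolding mult_le_cancel_left_pos[OF pos] by simp
      then show ?thesis by (simp add: cosh_real_nonneg_le_iff d_def)
    qed
    moreover have "dist (\<rho> (R - s)) (\<rho> t) = \<bar>R - L\<bar>"
      using geo_ray_dist[OF \<rho>, of "R - s" t] s t by (simp add: s_def)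
    ultimately show ?thesis
      using RL dist_triangle[of "\<sigma> t" "\<rho> t" "\<rho> (R - s)"] by (simp add: s_def d_def)
  qed
qed

text \<open>A cluster point of the segments from \<open>x\<close> to \<open>\<rho> n\<close>. The
  explicit bound, uniform over rays with the same origin, is what makes the change of base point in
  the cone topology work.\<close>

lemma ex_asymptotic_ray:
  fixes x :: "'a::metric_space"
  assumes cat: "CAT_minus1 (UNIV :: 'a set)"
    and proper: "proper_mspace (UNIV :: 'a set)" and \<rho>: "geo_ray \<rho>"
  shows "\<exists>\<rho>'. geo_ray \<rho>' \<and> \<rho>' 0 = x \<and> (\<forall>t\<ge>0. dist (\<rho>' t) (\<rho> t) \<le> 3 * dist x (\<rho> 0))"
proof -
  have "\<forall>n::nat. \<exists>\<sigma>. geoseg \<sigma> x (\<rho> (real n))" using ex_geoseg[OF cat] by blast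
  then obtain f :: "nat \<Rightarrow> real \<Rightarrow> 'a" where f: "\<And>n. geoseg (f n) x (\<rho> (real n))" by metis
  have long: "\<forall>\<^sub>F n in sequentially. t \<le> dist x (\<rho> n)" for t
    using eventually_ge_at_top[of "nat \<lceil>t + dist x (\<rho> 0)\<rceil>"]
  proof eventually_elim
    case (elim n)
    then have "t + dist x (\<rho> 0) \<le> n" by linarith
    then show ?case
      using dist_triangle[of "\<rho> 0" "\<rho> n" x] geo_ray_dist[OF \<rho>, of 0 n] by (simp add: dist_commute)
  qed
  have "\<exists>g. isom_on dist {0..} g \<and> (\<forall>t\<in>{0..}. \<forall>e>0. \<exists>\<^sub>F n in sequentially. dist (f n t) (g t) < e)"
  proof (rule ex_cluster_isometry[OF proper])
    fix s t :: real assume st: "s \<in> {0..}" "t \<in> {0..}"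
    show "\<forall>\<^sub>F n in sequentially. dist (f n s) (f n t) = \<bar>s - t\<bar>"
      using long[of s] long[of t]
      by eventually_elim (use f st in \<open>auto simp: geoseg_def isom_on_def\<close>)
    show "\<exists>y r. \<forall>\<^sub>F n in sequentially. dist y (f n t) \<le> r"
    proof (intro exI)
      show "\<forall>\<^sub>F n in sequentially. dist x (f n t) \<le> t"
        using long[of t]
      proof eventually_elim
        case (elim n)
        then show ?case
          using f[of n] st isom_onD[of dist "{0..dist x (\<rho> n)}" "f n" 0 t] by (auto simp: geoseg_def)
      qed
    qed
  qed
  then obtain g where g: "isom_on dist {0..} g"
      "\<And>t e. t \<ge> 0 \<Longrightarrow> e > 0 \<Longrightarrow> \<exists>\<^sub>F n in sequentially. dist (f n t) (g t) < e"
    by auto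
  have "g 0 = x"
    using closed_cluster[of "{x}" "\<lambda>n. f n 0" "g 0"] g(2)[of 0] f by (simp add: geoseg_def)
  moreover have "dist (g t) (\<rho> t) \<le> 3 * dist x (\<rho> 0)" if "t \<ge> 0" for t
  proof -
    have "g t \<in> cball (\<rho> t) (3 * dist x (\<rho> 0))"
    proof (rule closed_cluster[OF closed_cball _ g(2)[OF that]])
      show "\<forall>\<^sub>F n in sequentially. f n t \<in> cball (\<rho> t) (3 * dist x (\<rho> 0))"
        using long[of t]
        by eventually_elim
           (use CAT_dist_segment_ray[OF cat \<rho> f] that in \<open>auto simp: dist_commute\<close>)
    qed
    then show ?thesis by (simp add: dist_commute)
  qed
  ultimately show ?thesis using g(1) by (auto simp: geo_ray_def)
qed

text \<open>For fixed \<open>t\<close> and \<open>C\<close> the bound tends to 0 as \<open>R\<close>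
  grows: a bounded distance far out forces closeness near the origin. This gives uniqueness of rays
  in a class and continuity after a change of base point.\<close>

lemma geo_ray_dist_decay:
  fixes g g' :: "real \<Rightarrow> 'a::metric_space"
  assumes cat: "CAT_minus1 (UNIV :: 'a set)" and g: "geo_ray g" "geo_ray g'" "g 0 = g' 0"
    and R: "R > 0" "0 \<le> t" "t \<le> R" and C: "dist (g R) (g' R) \<le> C"
  shows "dist (g t) (g' t) \<le> 2 * (sinh t * sinh (C / 2)) / sinh R"
proof -
  have "sinh R * sinh (dist (g t) (g' t) / 2) \<le> sinh t * sinh (dist (g R) (g' R) / 2)"
    using CAT_decay[OF cat, of R g g' t] g R geo_ray_isom_on by blast
  also have "\<dots> \<le> sinh t * sinh (C / 2)"
    using R C by (intro mult_left_mono) auto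
  finally have "sinh (dist (g t) (g' t) / 2) \<le> sinh t * sinh (C / 2) / sinh R"
    using R by (simp add: field_simps)
  then show ?thesis
    using sinh_ge_self[of "dist (g t) (g' t) / 2"] by simp
qed

lemma asymptotic_rays_eq:
  fixes g g' :: "real \<Rightarrow> 'a::metric_space"
  assumes cat: "CAT_minus1 (UNIV :: 'a set)" and g: "geo_ray g" "geo_ray g'" "g 0 = g' 0"
    and "asymptotic g g'" and t: "t \<ge> 0"
  shows "g t = g' t"
proof -
  obtain C where C: "\<And>t. t \<ge> 0 \<Longrightarrow> dist (g t) (g' t) \<le> C"
    using assms by (auto simp: asymptotic_def)
  have "((\<lambda>R. 2 * (sinh t * sinh (C / 2)) / sinh R) \<longlongrightarrow> 0) at_top"
    by (intro tendsto_divide_0[OF tendsto_const] filterlim_at_top_imp_at_infinity sinh_real_at_top)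
  moreover have "\<forall>\<^sub>F R in at_top. dist (g t) (g' t) \<le> 2 * (sinh t * sinh (C / 2)) / sinh R"
    using eventually_gt_at_top[of t]
    by eventually_elim (use geo_ray_dist_decay[OF cat g] t C in auto)
  ultimately have "dist (g t) (g' t) \<le> 0"
    by (rule tendsto_lowerbound) simp
  then show ?thesis by simp
qed

section \<open>Depth along rays\<close>

lemma continuous_on_isom:
  fixes g :: "real \<Rightarrow> 'a::metric_space"
  assumes "isom_on dist I g"
  shows "continuous_on I g"
  unfolding continuous_on_iff using assms by (auto simp: isom_on_def dist_real_def)

lemma depth_fun_ray_lipschitz:
  assumes "depth_fun h" "geo_ray \<rho>" "0 \<le> s" "0 \<le> t"
  shows "h (\<rho> s) \<le> h (\<rho> t) + \<bar>s - t\<bar>"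
  using depth_fun_lipschitz[OF assms(1), of "\<rho> s" "\<rho> t"] geo_ray_dist[OF assms(2-4)] by simp

context
  fixes h :: "'a::metric_space \<Rightarrow> real"
  assumes cat: "CAT_minus1 (UNIV :: 'a set)" and h: "depth_fun h"
begin

lemma depth_fun_ray_quasiconcave:
  assumes "geo_ray \<rho>" "0 \<le> s" "s \<le> t" "t \<le> u"
  shows "min (h (\<rho> s)) (h (\<rho> u)) \<le> h (\<rho> t)"
proof (rule depth_fun_quasiconcave[OF cat h])
  show "isom_on dist {s..u} \<rho>"
    using assms by (auto simp: isom_on_def geo_ray_dist)
qed (use assms in auto)

text \<open>A ray cannot enter before time \<open>T = - h (\<rho> 0)\<close>. If it reaches depth 1,
  \<open>depth_fun_entry\<close> at \<open>T + 1/4\<close> gives depth at least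
  \<open>1/4 - exp (-3/4) / 2\<close>, which is positive. So all such rays from one point are inside
  at a common time.\<close>

lemma depth_fun_ray_positive:
  assumes \<rho>: "geo_ray \<rho>" and x: "h (\<rho> 0) \<le> 0" and m: "0 \<le> m" "1 \<le> h (\<rho> m)"
  shows "0 < h (\<rho> (- h (\<rho> 0) + 1 / 4))"
proof -
  define T where "T = - h (\<rho> 0)"
  have "h (\<rho> 0) + (T + 1 / 4) - exp ((T + 1 / 4) - (T + 1)) / 2 \<le> h (\<rho> (T + 1 / 4))"
    by (rule depth_fun_entry[OF cat h geo_ray_isom_on[OF \<rho>] m(1)]) (use m x in \<open>auto simp: T_def\<close>)
  moreover have "2 < exp (3 / 4 :: real)"
    using exp_lower_Taylor_quadratic[of "3 / 4 :: real"] by (simp add: power2_eq_square)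
  then have "exp (- (3 / 4) :: real) < 1 / 2"
    by (simp add: exp_minus field_simps)
  ultimately show ?thesis by (simp add: T_def)
qed

text \<open>By the midpoint estimate a geodesic cannot stay long at depths between 0 and 1.\<close>

lemma depth_fun_ray_early:
  assumes \<rho>: "geo_ray \<rho>" and x: "h (\<rho> 0) \<le> 0" and m: "0 \<le> m" "1 \<le> h (\<rho> m)"
  shows "\<exists>t\<in>{0..- h (\<rho> 0) + 17 / 4}. 1 \<le> h (\<rho> t)"
proof (cases "m \<le> - h (\<rho> 0) + 17 / 4")
  case True
  then show ?thesis using m by auto
next
  case False
  \<comment> \<open>If the ray is inside at \<open>p\<close> and at \<open>p + 4\<close>, its depth
    at \<open>p + 2\<close> exceeds \<open>2 - ln 2 > 1\<close>. Hence the bound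
    \<open>17/4 = 1/4 + 4\<close>.\<close>
  define p where "p = - h (\<rho> 0) + 1 / 4"
  have p: "0 \<le> p" "h (\<rho> p) > 0"
    using x depth_fun_ray_positive[OF assms] by (auto simp: p_def)
  have "min (h (\<rho> p)) (h (\<rho> m)) \<le> h (\<rho> (p + 4))"
    by (rule depth_fun_ray_quasiconcave[OF \<rho>]) (use p False in \<open>auto simp: p_def\<close>)
  then have p4: "h (\<rho> (p + 4)) > 0" using p m by simp
  have eq: "(p + (p + 4)) / 2 = p + 2" "(p + 4 - p) / 2 = 2" by simp_all
  have "isom_on dist {p..p + 4} \<rho>" using p \<rho> by (auto simp: isom_on_def geo_ray_dist)
  from depth_fun_midpoint[OF cat h this]
  have "min (h (\<rho> p)) (h (\<rho> (p + 4))) + (2 - ln 2) \<le> h (\<rho> (p + 2))"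
    unfolding eq by simp
  moreover have "min (h (\<rho> p)) (h (\<rho> (p + 4))) > 0" using p(2) p4 by simp
  ultimately have "1 \<le> h (\<rho> (p + 2))"
    using ln_2_less_1 by linarith
  then show ?thesis using p by (intro bexI[of _ "p + 2"]) (auto simp: p_def)
qed

end

text \<open>Move the end point of the ray along a path of the boundary towards the end point of a ray that
  runs away from the region, and stop when depth 1 is no longer exceeded.\<close>

lemma ex_ray_depth_one:
  fixes \<gamma> :: "real \<Rightarrow> 'a::metric_space"
  assumes cat: "CAT_minus1 (UNIV :: 'a set)" and proper: "proper_mspace (UNIV :: 'a set)"
    and ext: "extendible_geodesics (UNIV :: 'a set)" and arcwise: "bdry_arcwise_connected TYPE('a)"
    and h: "depth_fun h" and \<gamma>: "geo_ray \<gamma>" and x: "h (\<gamma> 0) \<le> 0" and deep: "t0 \<ge> 0" "h (\<gamma> t0) > 1"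
  shows "\<exists>\<gamma>'. geo_ray \<gamma>' \<and> \<gamma>' 0 = \<gamma> 0 \<and> (\<forall>t\<ge>0. h (\<gamma>' t) \<le> 1) \<and> (\<exists>m\<ge>0. h (\<gamma>' m) = 1)"
proof -
  obtain \<kappa> where \<kappa>: "geo_ray \<kappa>" "\<kappa> 0 = \<gamma> 0" "\<And>t. t \<ge> 0 \<Longrightarrow> h (\<kappa> t) \<le> h (\<gamma> 0)"
    using ex_ray_decreasing_depth[OF cat proper ext h] by blast
  define cl where "cl \<rho> = {\<rho>'. geo_ray \<rho>' \<and> asymptotic \<rho> \<rho>'}" for \<rho> :: "real \<Rightarrow> 'a"
  have clb: "cl \<rho> \<in> bdry" if "geo_ray \<rho>" for \<rho>
    using that by (auto simp: cl_def bdry_def)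
  from arcwise[unfolded bdry_arcwise_connected_def]
  obtain x0 :: 'a where x0: "\<forall>\<xi>\<in>bdry. \<forall>\<eta>\<in>bdry. \<exists>p. p 0 = \<xi> \<and> p 1 = \<eta> \<and> p ` {0..1} \<subseteq> bdry
        \<and> cone_continuous_path x0 p" ..
  from x0[rule_format, OF clb[OF \<gamma>] clb[OF \<kappa>(1)]]
  obtain p where p: "p 0 = cl \<gamma>" "p 1 = cl \<kappa>" "p ` {0..1} \<subseteq> bdry" "cone_continuous_path x0 p"
    by (elim exE conjE)
  define d where "d = dist (\<gamma> 0) x0"
  have "\<exists>\<rho>. \<rho> \<in> p s \<and> \<rho> 0 = x0" if s: "s \<in> {0..1}" for s
  proof -
    have ps: "p s \<in> bdry" using p(3) s by blast
    then obtain \<rho> where \<rho>: "\<rho> \<in> p s" using bdry_nonempty by blast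
    then obtain \<rho>' where "geo_ray \<rho>'" "\<rho>' 0 = x0" "\<forall>t\<ge>0. dist (\<rho>' t) (\<rho> t) \<le> 3 * dist x0 (\<rho> 0)"
      using ex_asymptotic_ray[OF cat proper bdry_memD[OF ps]] by blast
    then show ?thesis
      using bdry_mem_iff[OF ps \<rho>] by (auto simp: asymptotic_def dist_commute)
  qed
  then obtain \<rho> where \<rho>: "\<And>s. s \<in> {0..1} \<Longrightarrow> \<rho> s \<in> p s" "\<And>s. s \<in> {0..1} \<Longrightarrow> \<rho> s 0 = x0"
    by metis
  have \<rho>ray: "geo_ray (\<rho> s)" if "s \<in> {0..1}" for s
    using \<rho>(1)[OF that] p(3) that bdry_memD by blast
  have "\<exists>g. geo_ray g \<and> g 0 = \<gamma> 0 \<and> (\<forall>t\<ge>0. dist (g t) (\<rho> s t) \<le> 3 * d)" if "s \<in> {0..1}" for s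
    using ex_asymptotic_ray[OF cat proper \<rho>ray[OF that], of "\<gamma> 0"] \<rho>(2)[OF that] by (simp add: d_def)
  then obtain G where G: "\<And>s. s \<in> {0..1} \<Longrightarrow> geo_ray (G s)" "\<And>s. s \<in> {0..1} \<Longrightarrow> G s 0 = \<gamma> 0"
      "\<And>s t. s \<in> {0..1} \<Longrightarrow> t \<ge> 0 \<Longrightarrow> dist (G s t) (\<rho> s t) \<le> 3 * d"
    by metis
  \<comment> \<open>\<open>G s\<close> is the ray from \<open>\<gamma> 0\<close> in the class
    \<open>p s\<close>; by uniqueness the two ends of the path give back \<open>\<gamma>\<close> and
    \<open>\<kappa>\<close>.\<close>
  have ends: "G s t = g t" if "s \<in> {0..1}" "p s = cl g" "geo_ray g" "g 0 = \<gamma> 0" "t \<ge> 0" for s g t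
  proof (rule asymptotic_rays_eq[OF cat])
    have "asymptotic (G s) (\<rho> s)" using G(3) that by (auto simp: asymptotic_def)
    moreover have "asymptotic g (\<rho> s)" using \<rho>(1)[of s] that by (simp add: cl_def)
    ultimately show "asymptotic (G s) g" using asymptotic_sym asymptotic_trans by blast
  qed (use that G in auto)
  have cont: "\<exists>\<delta>>0. \<forall>s'\<in>{0..1}. \<bar>s' - s\<bar> < \<delta> \<longrightarrow> dist (G s t) (G s' t) < e"
    if s: "s \<in> {0..1}" and t: "t \<ge> 0" and e: "e > 0" for s t e
  proof -
    \<comment> \<open>Continuity is only given for the base point \<open>x0\<close>. Rays of one
      class are within \<open>3 * d\<close>, so two rays from \<open>x0\<close> within 1 at time
      \<open>R\<close> give rays from \<open>\<gamma> 0\<close> within \<open>6 * d + 1\<close>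
      there; a large \<open>R\<close> makes them close at time \<open>t\<close>.\<close>
    define C where "C = 6 * d + 1"
    have "((\<lambda>R. 2 * (sinh t * sinh (C / 2)) / sinh R) \<longlongrightarrow> 0) at_top"
      by (intro tendsto_divide_0[OF tendsto_const] filterlim_at_top_imp_at_infinity sinh_real_at_top)
    then have "\<forall>\<^sub>F R in at_top. 2 * (sinh t * sinh (C / 2)) / sinh R < e"
      using e by (rule order_tendstoD)
    then have "\<forall>\<^sub>F R in at_top. 2 * (sinh t * sinh (C / 2)) / sinh R < e \<and> R > t"
      using eventually_gt_at_top[of t] by eventually_elim simp
    then obtain R where R: "2 * (sinh t * sinh (C / 2)) / sinh R < e" "R > t"
      by (auto dest!: eventually_happens)
    obtain \<delta> where \<delta>: "\<delta> > 0" "\<And>s' \<rho> \<rho>'. s' \<in> {0..1} \<Longrightarrow> \<bar>s' - s\<bar> < \<delta> \<Longrightarrow> \<rho> \<in> p s \<Longrightarrow> \<rho> 0 = x0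
        \<Longrightarrow> \<rho>' \<in> p s' \<Longrightarrow> \<rho>' 0 = x0 \<Longrightarrow> dist (\<rho> R) (\<rho>' R) < 1"
      using p(4)[unfolded cone_continuous_path_def, rule_format, of s R 1] s R t by auto
    show ?thesis
    proof (intro exI[of _ \<delta>] conjI ballI impI \<delta>(1))
      fix s' assume s': "s' \<in> {0..1::real}" "\<bar>s' - s\<bar> < \<delta>"
      have "dist (\<rho> s R) (\<rho> s' R) < 1" using \<delta>(2) s s' \<rho> by blast
      moreover have "dist (G s R) (\<rho> s R) \<le> 3 * d" "dist (G s' R) (\<rho> s' R) \<le> 3 * d"
        using G(3) s s' R t by auto
      ultimately have "dist (G s R) (G s' R) \<le> C"
        using dist_triangle[of "G s R" "G s' R" "\<rho> s R"] dist_triangle[of "\<rho> s R" "G s' R" "\<rho> s' R"]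
        by (simp add: C_def dist_commute)
      then have "dist (G s t) (G s' t) \<le> 2 * (sinh t * sinh (C / 2)) / sinh R"
        using geo_ray_dist_decay[OF cat, of "G s" "G s'" R t C] G s s' R t by simp
      then show "dist (G s t) (G s' t) < e" using R by simp
    qed
  qed
  define Z where "Z = {s\<in>{0..1}. \<forall>t\<ge>0. h (G s t) \<le> 1}"
  have Z1: "1 \<in> Z" using ends[of 1 \<kappa>] p \<kappa> x by (fastforce simp: Z_def)
  have Z0: "0 \<notin> Z" using ends[of 0 \<gamma> t0] p \<gamma> deep by (auto simp: Z_def)
  have bdd: "bdd_below Z" by (auto simp: Z_def bdd_below_def)
  define z where "z = Inf Z"
  have "0 \<le> z" unfolding z_def
  proof (rule cInf_greatest)
    show "Z \<noteq> {}" using Z1 by blast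
  qed (simp add: Z_def)
  moreover have "z \<le> 1" unfolding z_def by (rule cInf_lower[OF Z1 bdd])
  ultimately have z01: "z \<in> {0..1}" by simp
  \<comment> \<open>Exceeding depth 1 at a given time is an open condition on the parameter, so the
    infimum belongs to \<open>Z\<close>.\<close>
  have zZ: "z \<in> Z"
  proof (rule ccontr)
    assume "z \<notin> Z"
    then obtain t where t: "t \<ge> 0" "h (G z t) > 1" using z01 by (force simp: Z_def)
    then obtain \<delta> where \<delta>: "\<delta> > 0" "\<forall>s'\<in>{0..1}. \<bar>s' - z\<bar> < \<delta> \<longrightarrow> dist (G z t) (G s' t) < h (G z t) - 1"
      using cont[OF z01 t(1), of "h (G z t) - 1"] by auto
    obtain s where s: "s \<in> Z" "s < z + \<delta>"
      using cInf_lessD[of Z "z + \<delta>"] Z1 \<delta> by (auto simp: z_def)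
    have "z \<le> s" using cInf_lower[OF s(1) bdd] by (simp add: z_def)
    then have "dist (G z t) (G s t) < h (G z t) - 1" using \<delta> s by (auto simp: Z_def)
    moreover have "h (G s t) \<le> 1" using s t by (auto simp: Z_def)
    ultimately show False
      using depth_fun_lipschitz[OF h, of "G z t" "G s t"] by simp
  qed
  have hz: "h (G z t) \<le> 1" if "t \<ge> 0" for t using zZ that by (simp add: Z_def)
  \<comment> \<open>By \<open>depth_fun_ray_early\<close> every ray from \<open>\<gamma> 0\<close>
    that reaches depth 1 does so by time \<open>B\<close>, independently of the ray. Thus the
    compact interval \<open>{0..B}\<close> is enough.\<close>
  define B where "B = - h (\<gamma> 0) + 17 / 4"
  have B: "B \<ge> 0" using x by (simp add: B_def)
  have "continuous_on {0..B} (\<lambda>t. h (G z t))"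
    using continuous_on_compose2[OF depth_fun_continuous[OF h] continuous_on_isom[OF geo_ray_isom_on[OF G(1)[OF z01]]]]
    by simp
  then obtain m where m: "m \<in> {0..B}" "\<And>t. t \<in> {0..B} \<Longrightarrow> h (G z t) \<le> h (G z m)"
    using continuous_attains_sup[of "{0..B}" "\<lambda>t. h (G z t)"] B by auto
  have "h (G z m) = 1"
  proof (rule ccontr)
    assume "h (G z m) \<noteq> 1"
    then have e: "1 - h (G z m) > 0" using hz[of m] m by auto
    then obtain \<delta> where \<delta>: "\<delta> > 0" "\<forall>s'\<in>{0..1}. \<bar>s' - z\<bar> < \<delta> \<longrightarrow> dist (G z B) (G s' B) < 1 - h (G z m)"
      using cont[OF z01 B e] by auto
    \<comment> \<open>A parameter slightly below the infimum: its ray exceeds depth 1, although it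
      is close to \<open>G z\<close> up to time \<open>B\<close>.\<close>
    define s where "s = max 0 (z - \<delta> / 2)"
    have "z \<noteq> 0" using zZ Z0 by auto
    then have s: "s \<in> {0..1}" "s < z" "\<bar>s - z\<bar> < \<delta>" using z01 \<delta> by (auto simp: s_def)
    then have "s \<notin> Z" using cInf_lower[OF _ bdd, of s] by (auto simp: z_def)
    then obtain u where "u \<ge> 0" "h (G s u) > 1" using s by (force simp: Z_def)
    then obtain t where t: "t \<in> {0..B}" "1 \<le> h (G s t)"
      using depth_fun_ray_early[OF cat h, of "G s" u] G s x by (force simp: B_def)
    have "dist (G z t) (G s t) \<le> dist (G z B) (G s B)"
      using t z01 s G by (intro CAT_dist_mono[OF cat] geo_ray_isom_on) auto
    also have "\<dots> < 1 - h (G z m)" using \<delta> s by blast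
    finally show False
      using depth_fun_lipschitz[OF h, of "G s t" "G z t"] t m(2)[OF t(1)] by (simp add: dist_commute)
  qed
  then show ?thesis
    using G z01 hz m by (intro exI[of _ "G z"]) auto
qed

section \<open>Avoiding a family of regions\<close>

lemma exp_quarter_le: "exp (1 / 4 :: real) \<le> 4 / 3"
  using exp_ge_add_one_self[of "- (1 / 4) :: real"] by (simp add: exp_minus field_simps)

text \<open>A ray at depth \<open>D\<close> needs at least time \<open>D\<close> to leave the
  region, so later modifications displace this point by at most \<open>exp (1/4 - D) / 2\<close>.
  This is the origin of the final bound \<open>3/2\<close>.\<close>

lemma depth_plus_error_le:
  fixes D :: real
  assumes "0 \<le> D" "D \<le> 1"
  shows "D + exp (1 / 4 - D) / 2 \<le> 3 / 2"
proof -
  have "exp D \<ge> 1 + D" by (rule exp_ge_add_one_self)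
  then have "exp (1 / 4 - D) \<le> (4 / 3) / (1 + D)"
    unfolding exp_diff using exp_quarter_le assms by (intro frac_le) auto
  also have "(4 / 3) / (1 + D) \<le> 2 * (3 / 2 - D)"
  proof -
    have "D * D \<le> D * 1" using assms by (intro mult_left_mono) auto
    then show ?thesis using assms by (simp add: field_simps)
  qed
  finally show ?thesis by simp
qed

text \<open>With \<open>u = t - T\<close> the terms are the displacement by one modification, the
  allowance for all later ones, and the allowance before it. The inequality says that the allowance
  never increases.\<close>

lemma error_sum_le: "exp (u - 1) + exp (u - 7 / 4) / 2 \<le> exp u / (2::real)"
proof -
  have 1: "5 / 2 \<le> exp (1::real)" "2 \<le> exp (3 / 4 :: real)"
    using exp_lower_Taylor_quadratic[of "1::real"] exp_lower_Taylor_quadratic[of "3 / 4 :: real"]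
    by (simp_all add: power2_eq_square)
  have "5 / 2 * 2 \<le> exp (1::real) * exp (3 / 4)"
    using 1 by (intro mult_mono) auto
  then have "exp (u - 7 / 4) \<le> exp u / 5"
    unfolding exp_diff by (intro divide_left_mono) (auto simp flip: exp_add)
  moreover have "exp (u - 1) \<le> exp u / (5 / 2)"
    unfolding exp_diff using 1 by (intro divide_left_mono) auto
  ultimately show ?thesis by simp
qed

text \<open>The summand \<open>exp (1/4 - (S - t)) / 2\<close> bounds the total displacement at time \<open>t\<close> that can
  still be caused by modifications of the ray which are made to avoid regions entered after time \<open>S\<close>.\<close>

definition avoiding_upto ::
    "('i \<Rightarrow> 'a::metric_space \<Rightarrow> real) \<Rightarrow> 'i set \<Rightarrow> (real \<Rightarrow> 'a) \<Rightarrow> real \<Rightarrow> (real \<Rightarrow> 'a) \<Rightarrow> real \<Rightarrow> bool" where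
  "avoiding_upto h A \<gamma>0 S0 \<gamma> S \<longleftrightarrow> geo_ray \<gamma> \<and> \<gamma> 0 = \<gamma>0 0 \<and> S0 \<le> S \<and>
     (\<forall>\<alpha>\<in>A. \<forall>t\<in>{0..S}. h \<alpha> (\<gamma> t) + exp (1 / 4 - (S - t)) / 2 \<le> 3 / 2) \<and>
     (\<forall>t\<in>{0..S0}. dist (\<gamma> t) (\<gamma>0 t) + exp (1 / 4 - (S - t)) / 2 \<le> exp (1 / 4) / 2) \<and>
     (\<forall>\<alpha>\<in>A. \<forall>t\<ge>S. 1 < h \<alpha> (\<gamma> t) \<longrightarrow> h \<alpha> (\<gamma> S) \<le> 0)"

context
  fixes h :: "'i \<Rightarrow> 'a::metric_space \<Rightarrow> real" and A :: "'i set" and \<gamma>0 :: "real \<Rightarrow> 'a" and S0 :: real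
  assumes cat: "CAT_minus1 (UNIV :: 'a set)" and proper: "proper_mspace (UNIV :: 'a set)"
    and ext: "extendible_geodesics (UNIV :: 'a set)" and arcwise: "bdry_arcwise_connected TYPE('a)"
    and h: "\<And>\<alpha>. \<alpha> \<in> A \<Longrightarrow> depth_fun (h \<alpha>)"
    and disj: "\<And>\<alpha> \<beta> y. \<alpha> \<in> A \<Longrightarrow> \<beta> \<in> A \<Longrightarrow> h \<alpha> y > 0 \<Longrightarrow> h \<beta> y > 0 \<Longrightarrow> \<alpha> = \<beta>"
    and \<gamma>0: "geo_ray \<gamma>0" and S0: "0 \<le> S0"
    and outside: "\<And>\<alpha> t. \<alpha> \<in> A \<Longrightarrow> t \<in> {0..S0} \<Longrightarrow> h \<alpha> (\<gamma>0 t) \<le> 0"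
begin

text \<open>The ray is replaced by one that reaches depth exactly 1 in the first offending region,
  and the new time \<open>S'\<close> is its exit time from that region. The old ray controls times
  up to \<open>T\<close>, the new one controls the rest.\<close>

lemma avoiding_upto_step:
  assumes av: "avoiding_upto h A \<gamma>0 S0 \<gamma> S" and hit: "\<exists>\<alpha>\<in>A. \<exists>t\<ge>S. 1 < h \<alpha> (\<gamma> t)"
  shows "\<exists>\<gamma>' S'. avoiding_upto h A \<gamma>0 S0 \<gamma>' S' \<and> S + 1 \<le> S'"
proof -
  have \<gamma>: "geo_ray \<gamma>" "\<gamma> 0 = \<gamma>0 0" "S0 \<le> S"
    and inv: "\<And>\<alpha> t. \<alpha> \<in> A \<Longrightarrow> t \<in> {0..S} \<Longrightarrow> h \<alpha> (\<gamma> t) + exp (1 / 4 - (S - t)) / 2 \<le> 3 / 2"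
    and close0: "\<And>t. t \<in> {0..S0} \<Longrightarrow> dist (\<gamma> t) (\<gamma>0 t) + exp (1 / 4 - (S - t)) / 2 \<le> exp (1 / 4) / 2"
    and later: "\<And>\<alpha> t. \<alpha> \<in> A \<Longrightarrow> t \<ge> S \<Longrightarrow> 1 < h \<alpha> (\<gamma> t) \<Longrightarrow> h \<alpha> (\<gamma> S) \<le> 0"
    using av by (auto simp: avoiding_upto_def)
  have S: "0 \<le> S" using \<gamma> S0 by simp
  have persist: "h \<beta> (g u) > 0" if "\<beta> \<in> A" "geo_ray g" "0 \<le> t" "t \<le> u" "u < t + h \<beta> (g t)" for \<beta> g t u
    using depth_fun_ray_lipschitz[OF h[OF that(1)] that(2), of t u] that by simp

  \<comment> \<open>\<open>\<alpha>\<close> is the first region entered to depth more than 1 after time \<open>S\<close>: such visits have duration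
    at least 2 and do not overlap, so it is enough to approximate the infimum of the times.\<close>
  define Q where "Q = {t. S \<le> t \<and> (\<exists>\<alpha>\<in>A. 1 < h \<alpha> (\<gamma> t))}"
  have Q: "Q \<noteq> {}" "bdd_below Q" using hit by (auto simp: Q_def bdd_below_def)
  obtain t1 where t1: "t1 \<in> Q" "t1 < Inf Q + 1 / 2"
    using cInf_lessD[OF Q(1), of "Inf Q + 1 / 2"] by auto
  then obtain \<alpha> where \<alpha>: "\<alpha> \<in> A" "1 < h \<alpha> (\<gamma> t1)" and St1: "S \<le> t1" by (auto simp: Q_def)
  \<comment> \<open>Such a \<open>t\<close> is within \<open>1/2\<close> of \<open>t1\<close>, so
    \<open>\<alpha>\<close> still has positive depth there and disjointness applies.\<close>
  have first: "\<beta> = \<alpha>" if "\<beta> \<in> A" "S \<le> t" "t \<le> t1" "1 < h \<beta> (\<gamma> t)" for \<beta> t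
  proof -
    have "t \<in> Q" using that by (auto simp: Q_def)
    then have "Inf Q \<le> t" using cInf_lower[OF _ Q(2)] by simp
    then have "h \<alpha> (\<gamma> t) > 0"
      using depth_fun_ray_lipschitz[OF h[OF \<alpha>(1)] \<gamma>(1), of t1 t] t1(2) \<alpha>(2) that S by simp
    then show ?thesis using disj[OF that(1) \<alpha>(1), of "\<gamma> t"] that(4) by simp
  qed

  define T where "T = - h \<alpha> (\<gamma> 0)"
  have T: "T \<ge> 0" using outside[OF \<alpha>(1), of 0] S0 \<gamma>(2) by (simp add: T_def)
  have before: "h \<alpha> (g t) \<le> t - T" if "geo_ray g" "g 0 = \<gamma> 0" "0 \<le> t" for g t
    using depth_fun_ray_lipschitz[OF h[OF \<alpha>(1)] that(1), of t 0] that by (simp add: T_def)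
  have Tt1: "T + 1 < t1" using before[OF \<gamma>(1), of t1] \<alpha>(2) St1 S by simp
  have in1: "h \<alpha> (\<gamma> (T + 1 / 4)) > 0"
    using depth_fun_ray_positive[OF cat h[OF \<alpha>(1)] \<gamma>(1), of t1] \<alpha> St1 S T by (simp add: T_def)
  \<comment> \<open>Otherwise \<open>S\<close> would lie between two times at which
    \<open>\<gamma>\<close> is inside \<open>\<alpha>\<close>, contradicting that
    \<open>\<alpha>\<close> is not entered at time \<open>S\<close>.\<close>
  have ST: "S \<le> T + 1 / 4"
  proof (rule ccontr)
    assume "\<not> ?thesis"
    then have "min (h \<alpha> (\<gamma> (T + 1 / 4))) (h \<alpha> (\<gamma> t1)) \<le> h \<alpha> (\<gamma> S)"
      by (intro depth_fun_ray_quasiconcave[OF cat h[OF \<alpha>(1)] \<gamma>(1)]) (use T St1 in auto)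
    then show False using later[OF \<alpha>(1) St1 \<alpha>(2)] in1 \<alpha>(2) by simp
  qed

  obtain \<gamma>' m where \<gamma>': "geo_ray \<gamma>'" "\<gamma>' 0 = \<gamma> 0" "\<And>t. t \<ge> 0 \<Longrightarrow> h \<alpha> (\<gamma>' t) \<le> 1"
      and m: "m \<ge> 0" "h \<alpha> (\<gamma>' m) = 1"
    using ex_ray_depth_one[OF cat proper ext arcwise h[OF \<alpha>(1)] \<gamma>(1), of t1] \<alpha> St1 S T
    by (auto simp: T_def)
  have mT: "T + 1 \<le> m" using before[OF \<gamma>'(1,2) m(1)] m(2) by simp
  have in2: "h \<alpha> (\<gamma>' (T + 1 / 4)) > 0"
    using depth_fun_ray_positive[OF cat h[OF \<alpha>(1)] \<gamma>'(1), of m] m \<gamma>' T by (simp add: T_def)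
  have close: "dist (\<gamma>' t) (\<gamma> t) \<le> exp (t - T - 1)" if "0 \<le> t" "t < T + 1" for t
    using depth_fun_close[OF cat h[OF \<alpha>(1)] geo_ray_isom_on[OF \<gamma>(1)] _ _ geo_ray_isom_on[OF \<gamma>'(1)] m(1) _ _ that,
        of t1] \<gamma>' m \<alpha> St1 S by (simp add: T_def dist_commute algebra_simps)

  define P where "P = {t. 0 \<le> t \<and> h \<alpha> (\<gamma>' t) > 0}"
  define S' where "S' = Sup P"
  \<comment> \<open>The depth of \<open>\<gamma>'\<close> never exceeds 1, so by the midpoint
    estimate a visit starting by \<open>T + 1/4\<close> lasts at most
    \<open>2 + 2 * ln 2 < 4\<close> after that time.\<close>
  have bddP: "bdd_above P"
  proof (rule bdd_aboveI[of _ "T + 17 / 4"])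
    fix t assume t: "t \<in> P"
    show "t \<le> T + 17 / 4"
    proof (cases "t \<le> T + 1 / 4")
      case False
      have "isom_on dist {T + 1 / 4..t} \<gamma>'"
        using T \<gamma>'(1) by (auto simp: isom_on_def geo_ray_dist)
      from depth_fun_midpoint[OF cat h[OF \<alpha>(1)] this] False
      have "min (h \<alpha> (\<gamma>' (T + 1 / 4))) (h \<alpha> (\<gamma>' t)) + ((t - (T + 1 / 4)) / 2 - ln 2)
          \<le> h \<alpha> (\<gamma>' ((T + 1 / 4 + t) / 2))" by simp
      also have "\<dots> \<le> 1" using \<gamma>'(3) False T by simp
      finally have "min (h \<alpha> (\<gamma>' (T + 1 / 4))) (h \<alpha> (\<gamma>' t)) + ((t - (T + 1 / 4)) / 2 - ln 2) \<le> 1" .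
      moreover have "min (h \<alpha> (\<gamma>' (T + 1 / 4))) (h \<alpha> (\<gamma>' t)) > 0" using in2 t by (simp add: P_def)
      ultimately show ?thesis using ln_2_less_1 by argo
    qed simp
  qed
  have leS': "t \<le> S'" if "t \<in> P" for t using cSup_upper[OF that bddP] by (simp add: S'_def)
  \<comment> \<open>Leaving from depth 1 takes at least one unit of time, just as reaching it did;
    together \<open>S'\<close> is at least \<open>T + 2\<close>.\<close>
  have "m + 1 \<le> S'"
  proof (rule dense_le_bounded[of m])
    fix w assume w: "m < w" "w < m + 1"
    then have "w \<in> P" using persist[OF \<alpha>(1) \<gamma>'(1) m(1), of w] m by (simp add: P_def)
    then show "w \<le> S'" by (rule leS')
  qed simp
  then have S'T: "T + 2 \<le> S'" using mT by simp
  have "T + 1 / 4 \<in> P" using in2 T by (simp add: P_def)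
  then have Pne: "P \<noteq> {}" by blast
  have inside: "h \<alpha> (\<gamma>' t) > 0" if tt: "T + 1 / 4 \<le> t" "t < S'" for t
  proof -
    obtain u where u: "u \<in> P" "t < u" using less_cSupD[OF Pne] tt(2) by (auto simp: S'_def)
    then have "min (h \<alpha> (\<gamma>' (T + 1 / 4))) (h \<alpha> (\<gamma>' u)) \<le> h \<alpha> (\<gamma>' t)"
      by (intro depth_fun_ray_quasiconcave[OF cat h[OF \<alpha>(1)] \<gamma>'(1)]) (use T tt in auto)
    then show ?thesis using in2 u by (auto simp: P_def)
  qed
  \<comment> \<open>A region of positive depth at \<open>S'\<close> would have positive depth
    slightly earlier too, at a time when \<open>\<gamma>'\<close> is still inside
    \<open>\<alpha>\<close>.\<close>
  have exit: "h \<beta> (\<gamma>' S') \<le> 0" if "\<beta> \<in> A" "\<beta> \<noteq> \<alpha>" for \<beta>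
  proof (rule ccontr)
    assume D: "\<not> ?thesis"
    then obtain u where u: "u \<in> P" "S' - h \<beta> (\<gamma>' S') < u"
      using less_cSupD[OF Pne, of "S' - h \<beta> (\<gamma>' S')"] by (auto simp: S'_def)
    have "h \<beta> (\<gamma>' u) > 0"
      using depth_fun_ray_lipschitz[OF h[OF that(1)] \<gamma>'(1), of S' u] u leS'[OF u(1)] S'T T
      by (simp add: P_def)
    then show False using disj[OF that(1) \<alpha>(1)] u that by (auto simp: P_def)
  qed

  have err: "exp (t - T - 1) + exp (1 / 4 - (S' - t)) / 2 \<le> exp (t - T) / 2" for t
  proof -
    have "exp (1 / 4 - (S' - t)) \<le> exp (t - T - 7 / 4)" using S'T by simp
    then show ?thesis using error_sum_le[of "t - T"] by linarith
  qed
  have errS: "exp (t - T) \<le> exp (1 / 4 - (S - t))" for t using ST by simp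

  have inv': "h \<beta> (\<gamma>' t) + exp (1 / 4 - (S' - t)) / 2 \<le> 3 / 2" if \<beta>: "\<beta> \<in> A" and t: "t \<in> {0..S'}" for \<beta> t
  proof (cases "t \<le> T")
    case True
    have "h \<beta> (\<gamma>' t) \<le> h \<beta> (\<gamma> t) + exp (t - T - 1)"
      using depth_fun_lipschitz[OF h[OF \<beta>], of "\<gamma>' t" "\<gamma> t"] close[of t] t True by simp
    then have 1: "h \<beta> (\<gamma>' t) + exp (1 / 4 - (S' - t)) / 2 \<le> h \<beta> (\<gamma> t) + exp (t - T) / 2"
      using err[of t] by simp
    show ?thesis
    proof (cases "t \<le> S")
      case True
      then have "h \<beta> (\<gamma> t) + exp (1 / 4 - (S - t)) / 2 \<le> 3 / 2" using inv[OF \<beta>] t by simp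
      then show ?thesis using 1 errS[of t] by linarith
    next
      case False
      define D where "D = h \<beta> (\<gamma> t)"
      have \<alpha>t: "h \<alpha> (\<gamma> t) \<le> 0" using before[OF \<gamma>(1), of t] t \<open>t \<le> T\<close> by simp
      show ?thesis
      proof (cases "D \<le> 0")
        case True
        have "exp (t - T) \<le> 1" using \<open>t \<le> T\<close> by simp
        then show ?thesis using 1 True unfolding D_def by linarith
      next
        case D: False
        then have ne: "\<beta> \<noteq> \<alpha>" using \<alpha>t by (auto simp: D_def)
        then have "D \<le> 1" using first[OF \<beta>, of t] False \<open>t \<le> T\<close> Tt1 by (force simp: D_def)
        then have "D + exp (1 / 4 - D) / 2 \<le> 3 / 2" using depth_plus_error_le[of D] D by simp
        \<comment> \<open>At \<open>T + 1/4\<close> the ray \<open>\<gamma>\<close> is inside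
          \<open>\<alpha>\<close>, so it has left \<open>\<beta>\<close> by then; leaving takes time
          at least \<open>D\<close>.\<close>
        moreover have "t + D \<le> T + 1 / 4"
        proof (rule ccontr)
          assume "\<not> ?thesis"
          then have "h \<beta> (\<gamma> (T + 1 / 4)) > 0"
            using persist[OF \<beta> \<gamma>(1), of t "T + 1 / 4"] t \<open>t \<le> T\<close> by (simp add: D_def)
          then show False using disj[OF \<beta> \<alpha>(1)] in1 ne by blast
        qed
        then have "exp (t - T) \<le> exp (1 / 4 - D)" by simp
        ultimately show ?thesis using 1 unfolding D_def by linarith
      qed
    qed
  next
    case False
    define D where "D = h \<beta> (\<gamma>' t)"
    show ?thesis
    proof (cases "D \<le> 0")
      case True
      have "exp (1 / 4 - (S' - t)) \<le> exp (1 / 4)" using t by simp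
      then show ?thesis using True exp_quarter_le unfolding D_def by linarith
    next
      case D: False
      \<comment> \<open>After time \<open>T\<close> the new ray meets \<open>\<alpha>\<close>, where
        the depth is capped at 1 and the exit is at \<open>S'\<close>, or a region left by
        \<open>T + 1/4\<close>, in which only depth at most \<open>1/4\<close> remains
        possible.\<close>
      have "D \<le> 1 \<and> t + D \<le> S'"
      proof (cases "\<beta> = \<alpha>")
        case True
        have "t + D \<le> S'"
        proof (rule dense_le_bounded[of t])
          fix w assume w: "t < w" "w < t + D"
          then have "w \<in> P" using persist[OF \<beta> \<gamma>'(1), of t w] t True by (simp add: P_def D_def)
          then show "w \<le> S'" by (rule leS')
        qed (use D in simp)
        then show ?thesis using \<gamma>'(3)[of t] t True by (simp add: D_def)
      next
        case ne: False
        have "t < T + 1 / 4"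
        proof (rule ccontr)
          assume "\<not> ?thesis"
          then show False
            using inside[of t] exit[OF \<beta> ne] disj[OF \<beta> \<alpha>(1), of "\<gamma>' t"] ne D t
            by (cases "t = S'") (auto simp: D_def)
        qed
        moreover have "t + D \<le> T + 1 / 4"
        proof (rule ccontr)
          assume "\<not> ?thesis"
          then have "h \<beta> (\<gamma>' (T + 1 / 4)) > 0"
            using persist[OF \<beta> \<gamma>'(1), of t "T + 1 / 4"] t calculation by (simp add: D_def)
          then show False using disj[OF \<beta> \<alpha>(1)] in2 ne by blast
        qed
        ultimately show ?thesis using False S'T by simp
      qed
      then have "exp (1 / 4 - (S' - t)) \<le> exp (1 / 4 - D)" "D + exp (1 / 4 - D) / 2 \<le> 3 / 2"
        using depth_plus_error_le[of D] D by simp_all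
      then show ?thesis unfolding D_def by linarith
    qed
  qed
  have close0': "dist (\<gamma>' t) (\<gamma>0 t) + exp (1 / 4 - (S' - t)) / 2 \<le> exp (1 / 4) / 2" if t: "t \<in> {0..S0}" for t
  proof -
    have "dist (\<gamma>' t) (\<gamma>0 t) \<le> dist (\<gamma> t) (\<gamma>0 t) + exp (t - T - 1)"
      using dist_triangle[of "\<gamma>' t" "\<gamma>0 t" "\<gamma> t"] close[of t] t \<gamma>(3) ST by simp
    then show ?thesis using err[of t] errS[of t] close0[OF t] by linarith
  qed
  have "avoiding_upto h A \<gamma>0 S0 \<gamma>' S'"
    unfolding avoiding_upto_def
  proof (intro conjI ballI allI impI)
    fix \<beta> t assume "\<beta> \<in> A" "S' \<le> t" "1 < h \<beta> (\<gamma>' t)"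
    moreover from this have "\<beta> \<noteq> \<alpha>" using \<gamma>'(3)[of t] S'T T by auto
    ultimately show "h \<beta> (\<gamma>' S') \<le> 0" using exit by blast
  qed (use \<gamma>'(1,2) \<gamma>(2,3) ST S'T inv' close0' in auto)
  then show ?thesis using ST S'T by (intro exI[of _ \<gamma>'] exI[of _ S']) auto
qed

text \<open>Each step advances \<open>S\<close> by at least 1. The second alternative covers the
  case that the process stops because no deep region lies ahead.\<close>

lemma ex_avoiding_upto:
  "\<exists>\<gamma> S. avoiding_upto h A \<gamma>0 S0 \<gamma> S \<and> (real n \<le> S \<or> (\<forall>\<alpha>\<in>A. \<forall>t\<ge>S. h \<alpha> (\<gamma> t) \<le> 1))"
proof (induction n)
  case 0
  have le: "exp (1 / 4 - (S0 - t)) \<le> exp (1 / 4)" if "t \<in> {0..S0}" for t using that by simp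
  have "avoiding_upto h A \<gamma>0 S0 \<gamma>0 S0"
    unfolding avoiding_upto_def
  proof (intro conjI ballI allI impI)
    fix \<alpha> t assume \<alpha>: "\<alpha> \<in> A" and t: "t \<in> {0..S0}"
    show "h \<alpha> (\<gamma>0 t) + exp (1 / 4 - (S0 - t)) / 2 \<le> 3 / 2"
      using le[OF t] outside[OF \<alpha> t] exp_quarter_le by linarith
  qed (use \<gamma>0 outside S0 le in auto)
  then show ?case using S0 by auto
next
  case (Suc n)
  then obtain \<gamma> S where *: "avoiding_upto h A \<gamma>0 S0 \<gamma> S"
      "real n \<le> S \<or> (\<forall>\<alpha>\<in>A. \<forall>t\<ge>S. h \<alpha> (\<gamma> t) \<le> 1)" by blast
  show ?case
  proof (cases "\<forall>\<alpha>\<in>A. \<forall>t\<ge>S. h \<alpha> (\<gamma> t) \<le> 1")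
    case True
    then show ?thesis using * by blast
  next
    case False
    then obtain \<gamma>' S' where "avoiding_upto h A \<gamma>0 S0 \<gamma>' S'" "S + 1 \<le> S'"
      using avoiding_upto_step[OF *(1)] by force
    then show ?thesis using False *(2) by (intro exI[of _ \<gamma>'] exI[of _ S']) auto
  qed
qed

text \<open>A cluster point of the rays from \<open>ex_avoiding_upto\<close>. For rays from a point,
  \<open>S0 = 0\<close>; for lines from a point at infinity, \<open>S0\<close> is the length of a
  long initial segment inside the horoball, and closeness to \<open>\<gamma>0\<close> there controls
  the end of the limit line.\<close>

lemma ex_avoiding_ray:
  "\<exists>\<gamma>. geo_ray \<gamma> \<and> \<gamma> 0 = \<gamma>0 0 \<and> (\<forall>\<alpha>\<in>A. \<forall>t\<ge>0. h \<alpha> (\<gamma> t) \<le> 3 / 2) \<and> (\<forall>t\<in>{0..S0}. dist (\<gamma> t) (\<gamma>0 t) \<le> 1)"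
proof -
  have "\<exists>\<gamma>. geo_ray \<gamma> \<and> \<gamma> 0 = \<gamma>0 0 \<and> (\<forall>\<alpha>\<in>A. \<forall>t\<in>{0..real n}. h \<alpha> (\<gamma> t) \<le> 3 / 2)
          \<and> (\<forall>t\<in>{0..S0}. dist (\<gamma> t) (\<gamma>0 t) \<le> 1)" for n
  proof -
    obtain \<gamma> S where av: "avoiding_upto h A \<gamma>0 S0 \<gamma> S"
        and S: "real n \<le> S \<or> (\<forall>\<alpha>\<in>A. \<forall>t\<ge>S. h \<alpha> (\<gamma> t) \<le> 1)"
      using ex_avoiding_upto by blast
    have "h \<alpha> (\<gamma> t) \<le> 3 / 2" if "\<alpha> \<in> A" "t \<in> {0..real n}" for \<alpha> t
    proof (cases "t \<le> S")
      case True
      then have "h \<alpha> (\<gamma> t) + exp (1 / 4 - (S - t)) / 2 \<le> 3 / 2"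
        using av that by (simp add: avoiding_upto_def)
      then show ?thesis using exp_ge_zero[of "1 / 4 - (S - t)"] by linarith
    next
      case False
      then have "h \<alpha> (\<gamma> t) \<le> 1" using S that by force
      then show ?thesis by simp
    qed
    moreover have "dist (\<gamma> t) (\<gamma>0 t) \<le> 1" if "t \<in> {0..S0}" for t
    proof -
      have "dist (\<gamma> t) (\<gamma>0 t) + exp (1 / 4 - (S - t)) / 2 \<le> exp (1 / 4) / 2"
        using av that by (simp add: avoiding_upto_def)
      then show ?thesis using exp_ge_zero[of "1 / 4 - (S - t)"] exp_quarter_le by linarith
    qed
    ultimately show ?thesis using av by (auto simp: avoiding_upto_def)
  qed
  then obtain f where f: "\<And>n. geo_ray (f n)" "\<And>n. f n 0 = \<gamma>0 0"
      "\<And>n \<alpha> t. \<alpha> \<in> A \<Longrightarrow> t \<in> {0..real n} \<Longrightarrow> h \<alpha> (f n t) \<le> 3 / 2"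
      "\<And>n t. t \<in> {0..S0} \<Longrightarrow> dist (f n t) (\<gamma>0 t) \<le> 1"
    by metis
  have "\<exists>g. isom_on dist {0..} g \<and> (\<forall>t\<in>{0..}. \<forall>e>0. \<exists>\<^sub>F n in sequentially. dist (f n t) (g t) < e)"
  proof (rule ex_cluster_isometry[OF proper])
    show "\<exists>y r. \<forall>\<^sub>F n in sequentially. dist y (f n t) \<le> r" if "t \<in> {0..}" for t
      using geo_ray_dist[OF f(1), of 0 t] f(2) that
      by (intro exI[of _ "\<gamma>0 0"] exI[of _ t]) simp
  qed (use f(1) in \<open>auto simp: geo_ray_dist\<close>)
  then obtain g where g: "isom_on dist {0..} g"
      "\<And>t e. t \<ge> 0 \<Longrightarrow> e > 0 \<Longrightarrow> \<exists>\<^sub>F n in sequentially. dist (f n t) (g t) < e"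
    by auto
  have "g 0 = \<gamma>0 0"
    using closed_cluster[of "{\<gamma>0 0}" "\<lambda>n. f n 0" "g 0"] g(2)[of 0] f(2) by simp
  moreover have "h \<alpha> (g t) \<le> 3 / 2" if \<alpha>: "\<alpha> \<in> A" and t: "t \<ge> 0" for \<alpha> t
  proof -
    have "closed {y. h \<alpha> y \<le> 3 / 2}"
      using depth_fun_continuous[OF h[OF \<alpha>]] by (intro closed_Collect_le) auto
    moreover have "\<forall>\<^sub>F n in sequentially. f n t \<in> {y. h \<alpha> y \<le> 3 / 2}"
      using eventually_ge_at_top[of "nat \<lceil>t\<rceil>"]
    proof eventually_elim
      case (elim n)
      then have "t \<le> real n" by linarith
      then show ?case using f(3)[OF \<alpha>, of t n] t by simp
    qed
    ultimately show ?thesis using closed_cluster[OF _ _ g(2)[OF t]] by blast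
  qed
  moreover have "dist (g t) (\<gamma>0 t) \<le> 1" if t: "t \<in> {0..S0}" for t
  proof -
    have "g t \<in> cball (\<gamma>0 t) 1"
      by (rule closed_cluster[OF closed_cball _ g(2)]) (use f(4)[OF t] t in \<open>auto simp: dist_commute\<close>)
    then show ?thesis by (simp add: dist_commute)
  qed
  ultimately show ?thesis using g(1) by (auto simp: geo_ray_def)
qed

end

section \<open>Busemann functions and the depth of a region\<close>

lemma busemann_tendsto:
  assumes "\<xi> \<in> bdry"
  shows "\<exists>\<rho>\<in>\<xi>. \<forall>x y. ((\<lambda>t. dist x (\<rho> t) - dist y (\<rho> t)) \<longlongrightarrow> busemann \<xi> x y) at_top"
proof -
  \<comment> \<open>The very representative chosen by \<open>busemann\<close>. The limit exists
    since \<open>dist x (\<rho> t) - t\<close> is nonincreasing and bounded below.\<close>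
  define \<rho> where "\<rho> = (SOME \<rho>. \<rho> \<in> \<xi>)"
  have \<rho>: "\<rho> \<in> \<xi>" unfolding \<rho>_def by (rule someI_ex[OF bdry_nonempty[OF assms]])
  then have ray: "geo_ray \<rho>" by (rule bdry_memD[OF assms])
  have conv: "\<exists>l. ((\<lambda>t. dist x (\<rho> t) - t) \<longlongrightarrow> l) at_top" for x
  proof -
    let ?f = "\<lambda>t. dist x (\<rho> t) - t"
    have anti: "?f t \<le> ?f s" if "0 \<le> s" "s \<le> t" for s t
      using dist_triangle[of x "\<rho> t" "\<rho> s"] geo_ray_dist[OF ray, of s t] that by simp
    have bdd: "bdd_below (?f ` {0..})"
    proof (rule bdd_belowI2[of _ "- dist x (\<rho> 0)"])
      fix t :: real assume "t \<in> {0..}"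
      then show "- dist x (\<rho> 0) \<le> ?f t"
        using dist_triangle[of "\<rho> 0" "\<rho> t" x] geo_ray_dist[OF ray, of 0 t] by (simp add: dist_commute)
    qed
    have "(?f \<longlongrightarrow> (INF t\<in>{0..}. ?f t)) at_top"
    proof (rule decreasing_tendsto)
      show "\<forall>\<^sub>F t in at_top. (INF t\<in>{0..}. ?f t) \<le> ?f t"
        using eventually_ge_at_top[of 0] by eventually_elim (rule cINF_lower[OF bdd], simp)
      fix l assume "(INF t\<in>{0..}. ?f t) < l"
      then obtain s where "s \<ge> 0" "?f s < l" using cInf_lessD[of "?f ` {0..}" l] by auto
      note s = this
      show "\<forall>\<^sub>F t in at_top. ?f t < l"
        using eventually_ge_at_top[of s]
        by eventually_elim (rule le_less_trans[OF anti[OF s(1)] s(2)])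
    qed
    then show ?thesis ..
  qed
  have "((\<lambda>t. dist x (\<rho> t) - dist y (\<rho> t)) \<longlongrightarrow> busemann \<xi> x y) at_top" for x y
  proof -
    obtain l l' where "((\<lambda>t. dist x (\<rho> t) - t) \<longlongrightarrow> l) at_top" "((\<lambda>t. dist y (\<rho> t) - t) \<longlongrightarrow> l') at_top"
      using conv by blast
    from tendsto_diff[OF this] have "((\<lambda>t. dist x (\<rho> t) - dist y (\<rho> t)) \<longlongrightarrow> l - l') at_top" by simp
    moreover from this have "busemann \<xi> x y = l - l'"
      unfolding busemann_def \<rho>_def[symmetric] Let_def by (intro tendsto_Lim) simp_all
    ultimately show ?thesis by simp
  qed
  then show ?thesis using \<rho> by (intro bexI[of _ \<rho>] allI)
qed

fun depth :: "'a::metric_space region \<Rightarrow> 'a \<Rightarrow> real" where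
  "depth (Ball c r) y = r - dist c y"
| "depth (Horoball \<xi> x s) y = busemann \<xi> x y - s"

lemma mem_shrink_iff: "y \<in> shrink H t \<longleftrightarrow> t \<le> depth H y"
  by (cases H) auto

lemma depth_fun_depth:
  assumes "region_wf H"
  shows "depth_fun (depth H)"
proof (cases H)
  case (Ball c r)
  then show ?thesis
    unfolding depth_fun_def by (intro exI[of _ "\<lambda>_. c"] exI[of _ "\<lambda>_. r"]) simp
next
  case (Horoball \<xi> x s)
  then have "\<xi> \<in> bdry" using assms by simp
  from busemann_tendsto[OF this]
  obtain \<rho> where "\<rho> \<in> \<xi>" and \<rho>: "\<forall>x y. ((\<lambda>t. dist x (\<rho> t) - dist y (\<rho> t)) \<longlongrightarrow> busemann \<xi> x y) at_top"
    by (elim bexE)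
  have "(\<lambda>n::nat. (dist x (\<rho> n) - s) - dist (\<rho> n) y) \<longlonglongrightarrow> depth H y" for y
  proof -
    have "(\<lambda>n::nat. dist x (\<rho> n) - dist y (\<rho> n) - s) \<longlonglongrightarrow> busemann \<xi> x y - s"
      by (intro tendsto_diff tendsto_const filterlim_compose[OF \<rho>[rule_format] filterlim_real_sequentially])
    then show ?thesis by (simp add: Horoball dist_commute algebra_simps)
  qed
  then show ?thesis
    unfolding depth_fun_def
    by (intro exI[of _ "\<lambda>n. \<rho> (real n)"] exI[of _ "\<lambda>n. dist x (\<rho> (real n)) - s"] allI)
qed

text \<open>Turns disjointness of interiors into the form used by the construction: no point has
  positive depth in two regions.\<close>

lemma depth_pos_imp_interior:
  assumes "region_wf H" "depth H y > 0"
  shows "y \<in> interior (region_set H)"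
proof (rule interiorI)
  show "open {y. 0 < depth H y}"
    using depth_fun_continuous[OF depth_fun_depth[OF assms(1)]] by (intro open_Collect_less) auto
qed (use assms(2) in \<open>auto simp: mem_shrink_iff\<close>)

lemma horoball_depth_along_ray:
  assumes "\<xi> \<in> bdry"
  shows "\<exists>\<rho>\<in>\<xi>. \<forall>t\<ge>0. depth (Horoball \<xi> x s) (\<rho> t) = depth (Horoball \<xi> x s) (\<rho> 0) + t"
proof -
  from busemann_tendsto[OF assms]
  obtain \<rho> where \<rho>: "\<rho> \<in> \<xi>" "\<forall>x y. ((\<lambda>t. dist x (\<rho> t) - dist y (\<rho> t)) \<longlongrightarrow> busemann \<xi> x y) at_top"
    by (elim bexE)
  have ray: "geo_ray \<rho>" using bdry_memD[OF assms \<rho>(1)] .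
  have *: "busemann \<xi> x (\<rho> t) = busemann \<xi> x (\<rho> 0) + t" if t: "t \<ge> 0" for t
  proof (rule tendsto_unique[OF _ \<rho>(2)[rule_format]])
    have "((\<lambda>u. dist x (\<rho> u) - dist (\<rho> 0) (\<rho> u) + t) \<longlongrightarrow> busemann \<xi> x (\<rho> 0) + t) at_top"
      by (intro tendsto_intros \<rho>(2)[rule_format])
    then show "((\<lambda>u. dist x (\<rho> u) - dist (\<rho> t) (\<rho> u)) \<longlongrightarrow> busemann \<xi> x (\<rho> 0) + t) at_top"
      by (rule Lim_transform_eventually)
         (use eventually_ge_at_top[of t] in \<open>eventually_elim; use t geo_ray_dist[OF ray] in auto\<close>)
  qed simp
  show ?thesis
  proof (intro bexI[of _ \<rho>] allI impI \<rho>(1))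
    fix t :: real assume "t \<ge> 0"
    from *[OF this] show "depth (Horoball \<xi> x s) (\<rho> t) = depth (Horoball \<xi> x s) (\<rho> 0) + t"
      unfolding depth.simps by linarith
  qed
qed

section \<open>Rays from points and lines from points at infinity\<close>

theorem theorem4p1:
  fixes H :: "'i \<Rightarrow> ('a::metric_space) region" and A :: "'i set" and \<mu>0 :: real
  assumes proper: "proper_mspace (UNIV::'a set)"
    and cat: "CAT_minus1 (UNIV::'a set)"
    and two_points: "\<exists>x y::'a. x \<noteq> y"
    and arcwise: "bdry_arcwise_connected TYPE('a)"
    and ext: "extendible_geodesics (UNIV::'a set)"
    and wf: "\<forall>\<alpha>\<in>A. region_wf (H \<alpha>)"
    and disj: "\<forall>\<alpha>\<in>A. \<forall>\<beta>\<in>A. \<alpha> \<noteq> \<beta> \<longrightarrow>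
                 interior (region_set (H \<alpha>)) \<inter> interior (region_set (H \<beta>)) = {}"
    and mu0: "\<mu>0 = 1.534"
  shows "(\<forall>x. x \<notin> (\<Union>\<alpha>\<in>A. region_set (H \<alpha>)) \<longrightarrow>
            (\<exists>\<rho>. geo_ray \<rho> \<and> \<rho> 0 = x \<and> (\<forall>\<alpha>\<in>A. \<forall>t\<ge>0. \<rho> t \<notin> shrink (H \<alpha>) \<mu>0)))
       \<and> (\<forall>\<alpha>0\<in>A. \<forall>\<xi> x s. H \<alpha>0 = Horoball \<xi> x s \<longrightarrow>
            (\<exists>\<gamma>. geo_line \<gamma> \<and> (\<lambda>t. \<gamma> (- t)) \<in> \<xi> \<and>
                 (\<forall>\<alpha>\<in>A - {\<alpha>0}. \<forall>t. \<gamma> t \<notin> shrink (H \<alpha>) \<mu>0)))"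
proof -
  have dep: "depth_fun (depth (H \<alpha>))" if "\<alpha> \<in> A" for \<alpha>
    using wf that depth_fun_depth by blast
  have dj: "\<alpha> = \<beta>" if "\<alpha> \<in> A" "\<beta> \<in> A" "depth (H \<alpha>) y > 0" "depth (H \<beta>) y > 0" for \<alpha> \<beta> y
    using disj wf depth_pos_imp_interior that by (metis disjoint_iff)
  have avoid: "y \<notin> shrink (H \<alpha>) \<mu>0" if "depth (H \<alpha>) y \<le> 3 / 2" for \<alpha> y
    using that mu0 by (simp add: mem_shrink_iff)
  have line: "\<exists>l. geo_line l \<and> (\<forall>t\<in>{a..b}. l t = g t)" if "a \<le> b" "isom_on dist {a..b} g" for a b and g :: "real \<Rightarrow> 'a"
    using ext[unfolded extendible_geodesics_def] that by blast
  have part1: "\<exists>\<rho>. geo_ray \<rho> \<and> \<rho> 0 = x \<and> (\<forall>\<alpha>\<in>A. \<forall>t\<ge>0. \<rho> t \<notin> shrink (H \<alpha>) \<mu>0)"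
    if x: "x \<notin> (\<Union>\<alpha>\<in>A. region_set (H \<alpha>))" for x
  proof -
    \<comment> \<open>The degenerate segment at \<open>x\<close> extends to a line, which provides a
      starting ray.\<close>
    obtain l where l: "geo_line l" "l 0 = x"
      using line[of 0 0 "\<lambda>_. x"] by (auto simp: isom_on_def)
    have "geo_ray l" using l by (auto simp: geo_line_def geo_ray_def isom_on_def)
    moreover have "depth (H \<alpha>) (l t) \<le> 0" if "\<alpha> \<in> A" "t \<in> {0..0}" for \<alpha> t
      using that x l mem_shrink_iff[of x "H \<alpha>" 0] by force
    ultimately have "\<exists>\<gamma>. geo_ray \<gamma> \<and> \<gamma> 0 = l 0 \<and> (\<forall>\<alpha>\<in>A. \<forall>t\<ge>0. depth (H \<alpha>) (\<gamma> t) \<le> 3 / 2)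
        \<and> (\<forall>t\<in>{0..0}. dist (\<gamma> t) (l t) \<le> 1)"
      by (intro ex_avoiding_ray cat proper ext arcwise dep) (auto intro: dj)
    then show ?thesis using l(2) avoid by blast
  qed
  have part2: "\<exists>\<gamma>. geo_line \<gamma> \<and> (\<lambda>t. \<gamma> (- t)) \<in> \<xi> \<and> (\<forall>\<alpha>\<in>A - {\<alpha>0}. \<forall>t. \<gamma> t \<notin> shrink (H \<alpha>) \<mu>0)"
    if \<alpha>0: "\<alpha>0 \<in> A" and H0: "H \<alpha>0 = Horoball \<xi> x s" for \<alpha>0 \<xi> x s
  proof -
    have \<xi>: "\<xi> \<in> bdry" using wf \<alpha>0 H0 by force
    from horoball_depth_along_ray[OF this, of x s]
    obtain \<rho> where \<rho>: "\<rho> \<in> \<xi>" "\<forall>t\<ge>0. depth (H \<alpha>0) (\<rho> t) = depth (H \<alpha>0) (\<rho> 0) + t"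
      unfolding H0 by (elim bexE)
    have ray: "geo_ray \<rho>" using bdry_memD[OF \<xi> \<rho>(1)] .
    \<comment> \<open>From time \<open>\<tau>\<close> on, \<open>\<rho>\<close> has positive depth
      in the horoball and is therefore outside every other region.\<close>
    define \<tau> where "\<tau> = \<bar>depth (H \<alpha>0) (\<rho> 0)\<bar> + 1"
    have \<tau>: "\<tau> \<ge> 0" by (simp add: \<tau>_def)
    have out: "depth (H \<alpha>) (\<rho> t) \<le> 0" if "\<alpha> \<in> A - {\<alpha>0}" "t \<ge> \<tau>" for \<alpha> t
    proof -
      have "depth (H \<alpha>0) (\<rho> t) > 0" using \<rho>(2)[rule_format, of t] that \<tau> unfolding \<tau>_def by linarith
      then show ?thesis using dj[of \<alpha> \<alpha>0 "\<rho> t"] that \<alpha>0 by force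
    qed
    \<comment> \<open>The ray \<open>\<rho>\<close> is run backwards from \<open>\<rho> i\<close>
      and extended; the initial segment of length \<open>i - \<tau>\<close> lies in the horoball.
      Shifting time by \<open>i\<close> makes \<open>f t\<close> comparable with
      \<open>\<rho> (- t)\<close> for every \<open>i\<close>.\<close>
    have seg: "\<exists>f. isom_on dist {-i..} f \<and> (\<forall>\<alpha>\<in>A - {\<alpha>0}. \<forall>t\<ge>-i. depth (H \<alpha>) (f t) \<le> 3 / 2)
             \<and> (\<forall>t\<in>{-i..-\<tau>}. dist (f t) (\<rho> (- t)) \<le> 1)" if i: "i \<ge> \<tau>" for i
    proof -
      have "isom_on dist {0..i} (\<lambda>t. \<rho> (i - t))"
        using ray by (auto simp: isom_on_def geo_ray_dist)
      then obtain l where l: "geo_line l" "\<And>t. t \<in> {0..i} \<Longrightarrow> l t = \<rho> (i - t)"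
        using line[of 0 i "\<lambda>t. \<rho> (i - t)"] i \<tau> by auto
      have "geo_ray l" using l by (auto simp: geo_line_def geo_ray_def isom_on_def)
      moreover have "depth (H \<alpha>) (l t) \<le> 0" if "\<alpha> \<in> A - {\<alpha>0}" "t \<in> {0..i - \<tau>}" for \<alpha> t
        using out[of \<alpha> "i - t"] l(2)[of t] that \<tau> by simp
      moreover have "depth_fun (depth (H \<alpha>))" if "\<alpha> \<in> A - {\<alpha>0}" for \<alpha>
        using dep that by blast
      ultimately have "\<exists>\<gamma>. geo_ray \<gamma> \<and> \<gamma> 0 = l 0 \<and>
          (\<forall>\<alpha>\<in>A - {\<alpha>0}. \<forall>t\<ge>0. depth (H \<alpha>) (\<gamma> t) \<le> 3 / 2) \<and> (\<forall>t\<in>{0..i - \<tau>}. dist (\<gamma> t) (l t) \<le> 1)"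
        using i by (intro ex_avoiding_ray cat proper ext arcwise) (auto intro: dj)
      then obtain \<gamma> where \<gamma>: "geo_ray \<gamma>"
          "\<And>\<alpha> t. \<alpha> \<in> A - {\<alpha>0} \<Longrightarrow> t \<ge> 0 \<Longrightarrow> depth (H \<alpha>) (\<gamma> t) \<le> 3 / 2"
          "\<And>t. t \<in> {0..i - \<tau>} \<Longrightarrow> dist (\<gamma> t) (l t) \<le> 1"
        by blast
      show ?thesis
      proof (intro exI[of _ "\<lambda>t. \<gamma> (t + i)"] conjI ballI allI impI)
        show "isom_on dist {-i..} (\<lambda>t. \<gamma> (t + i))"
          using \<gamma>(1) by (auto simp: isom_on_def geo_ray_dist)
        show "depth (H \<alpha>) (\<gamma> (t + i)) \<le> 3 / 2" if "\<alpha> \<in> A - {\<alpha>0}" "- i \<le> t" for \<alpha> t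
          using \<gamma>(2) that by simp
        show "dist (\<gamma> (t + i)) (\<rho> (- t)) \<le> 1" if "t \<in> {-i..-\<tau>}" for t
          using \<gamma>(3)[of "t + i"] l(2)[of "t + i"] that \<tau> by simp
      qed
    qed
    have "\<exists>f. isom_on dist {-(\<tau> + real n)..} f \<and> (\<forall>\<alpha>\<in>A - {\<alpha>0}. \<forall>t\<ge>-(\<tau> + real n). depth (H \<alpha>) (f t) \<le> 3 / 2)
             \<and> (\<forall>t\<in>{-(\<tau> + real n)..-\<tau>}. dist (f t) (\<rho> (- t)) \<le> 1)" for n
      by (rule seg) simp
    then obtain f where f: "\<And>n. isom_on dist {-(\<tau> + real n)..} (f n)"
        "\<And>n \<alpha> t. \<alpha> \<in> A - {\<alpha>0} \<Longrightarrow> t \<ge> -(\<tau> + real n) \<Longrightarrow> depth (H \<alpha>) (f n t) \<le> 3 / 2"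
        "\<And>n t. t \<in> {-(\<tau> + real n)..-\<tau>} \<Longrightarrow> dist (f n t) (\<rho> (- t)) \<le> 1"
      by metis
    have ev: "\<forall>\<^sub>F n in sequentially. t \<ge> - (\<tau> + real n)" for t
      using eventually_ge_at_top[of "nat \<lceil>- t - \<tau>\<rceil>"] by eventually_elim linarith
    have "\<exists>g. isom_on dist UNIV g \<and> (\<forall>t\<in>UNIV. \<forall>e>0. \<exists>\<^sub>F n in sequentially. dist (f n t) (g t) < e)"
    proof (rule ex_cluster_isometry[OF proper])
      fix u t :: real
      show "\<forall>\<^sub>F n in sequentially. dist (f n u) (f n t) = \<bar>u - t\<bar>"
        using ev[of u] ev[of t] by eventually_elim (use f(1) in \<open>auto simp: isom_on_def\<close>)
      show "\<exists>y r. \<forall>\<^sub>F n in sequentially. dist y (f n t) \<le> r"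
      proof (intro exI)
        \<comment> \<open>All \<open>f n\<close> are anchored at time \<open>-\<tau>\<close>, where
          they lie within 1 of \<open>\<rho> \<tau>\<close>.\<close>
        show "\<forall>\<^sub>F n in sequentially. dist (\<rho> \<tau>) (f n t) \<le> 1 + \<bar>- \<tau> - t\<bar>"
          using ev[of t]
        proof eventually_elim
          case (elim n)
          then show ?case
            using f(3)[of "-\<tau>" n] isom_onD[OF f(1), of "-\<tau>" n t] dist_triangle[of "\<rho> \<tau>" "f n t" "f n (-\<tau>)"]
            by (simp add: dist_commute)
        qed
      qed
    qed
    then obtain g where g: "isom_on dist UNIV g"
        "\<And>t e. e > 0 \<Longrightarrow> \<exists>\<^sub>F n in sequentially. dist (f n t) (g t) < e"
      by auto
    have "depth (H \<alpha>) (g t) \<le> 3 / 2" if \<alpha>: "\<alpha> \<in> A - {\<alpha>0}" for \<alpha> t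
    proof -
      have "closed {y. depth (H \<alpha>) y \<le> 3 / 2}"
        using depth_fun_continuous[OF dep] \<alpha> by (intro closed_Collect_le) auto
      moreover have "\<forall>\<^sub>F n in sequentially. f n t \<in> {y. depth (H \<alpha>) y \<le> 3 / 2}"
        using ev[of t] by eventually_elim (use f(2)[OF \<alpha>] in auto)
      ultimately show ?thesis using closed_cluster[OF _ _ g(2)] by blast
    qed
    moreover have "(\<lambda>t. g (- t)) \<in> \<xi>"
    proof -
      have far: "dist (g (- t)) (\<rho> t) \<le> 1" if t: "t \<ge> \<tau>" for t
      proof -
        have "\<forall>\<^sub>F n in sequentially. f n (- t) \<in> cball (\<rho> t) 1"
          using ev[of "-t"] by eventually_elim (use f(3)[of "-t"] t in \<open>auto simp: dist_commute\<close>)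
        then have "g (- t) \<in> cball (\<rho> t) 1"
          by (rule closed_cluster[OF closed_cball _ g(2)])
        then show ?thesis by (simp add: dist_commute)
      qed
      \<comment> \<open>Before time \<open>\<tau>\<close> both rays are followed to their points at
        \<open>\<tau>\<close>, which are within 1 of each other.\<close>
      have "dist (\<rho> t) (g (- t)) \<le> 1 + 2 * \<tau>" if t: "t \<ge> 0" for t
      proof (cases "t \<ge> \<tau>")
        case True
        then show ?thesis using far[of t] \<tau> by (simp add: dist_commute)
      next
        case False
        then show ?thesis
          using far[of \<tau>] t geo_ray_dist[OF ray, of t \<tau>] isom_onD[OF g(1), of "-\<tau>" "-t"]
            dist_triangle[of "\<rho> t" "g (- t)" "\<rho> \<tau>"] dist_triangle[of "\<rho> \<tau>" "g (- t)" "g (- \<tau>)"] \<tau>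
          by (simp add: dist_commute)
      qed
      then have "asymptotic \<rho> (\<lambda>t. g (- t))" by (auto simp: asymptotic_def)
      moreover have "geo_ray (\<lambda>t. g (- t))" using g(1) by (auto simp: geo_ray_def isom_on_def)
      ultimately show ?thesis using bdry_mem_iff[OF \<xi> \<rho>(1)] by blast
    qed
    ultimately show ?thesis using g(1) avoid by (auto simp: geo_line_def)
  qed
  show ?thesis using part1 part2 by blast
qed

end
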